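(* Let $\mathcal U$ be a unitary 4-design on $\mathcal H$ and $O$ a traceless Hermitian operator on $\mathcal H$. Then $V_*(O)\le \frac{4}{d}\|O\|_2^2$. If moreover $O=|\phi\rangle\langle\phi|-\mathbb 1/d$ for a pure state $|\phi\rangle\in\mathcal H$, then $$V_*(O)=V_*(O,\phi)=\frac{4(d-1)}{(d+2)(d+3)}<\frac4d.$$
   Context: Let $n\ge1$, $d=2^n$, $\mathcal H=(\mathbb C^2)^{\otimes n}$ with computational basis $\{|\mathbf b\rangle\}_{\mathbf b\in\{0,1\}^n}$. A unitary ensemble $\mathcal U$ is a probability distribution on $U(d)$; its measurement channel is $\mathcal M(X)=\mathbb E_{U\sim\mathcal U}\sum_{\mathbf b}\langle\mathbf b|UXU^\dagger|\mathbf b\rangle\,U^\dagger|\mathbf b\rangle\langle\mathbf b|U$ (for a 2-design, $\mathcal M^{-1}(O)=(d+1)O-\operatorname{tr}(O)\mathbb 1$). For a density operator $\rho$ and traceless Hermitian $O$, $V_*(O,\rho)=\mathbb E_{U\sim\mathcal U}\bigl(\sum_{\mathbf b}\langle\mathbf b|U\rho U^\dagger|\mathbf b\rangle\langle\mathbf b|U\mathcal M^{-1}(O)U^\dagger|\mathbf b\rangle\bigr)^2-[\operatorname{tr}(O\rho)]^2$; $V_*(O)=\max_\rho V_*(O,\rho)$ over all density operators; for a pure state $\rho=|\phi\rangle\langle\phi|$ one writes $V_*(O,\phi)$. $\|O\|_2$ is the Hilbert–Schmidt norm. *)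

theory Defs
  imports "HOL-Analysis.Analysis" "HOL-Probability.Probability"
begin

text \<open>Operators on H = (C^2)^{\<otimes>n} are complex d x d matrices indexed by a finite type 'd with
  CARD('d) = d = 2^n; the computational basis vector |b> is the b-th standard basis vector.\<close>

type_synonym 'd cmat = "complex^'d^'d"

definition cadj :: "'d::finite cmat \<Rightarrow> 'd cmat" where
  "cadj A = (\<chi> i j. cnj (A $ j $ i))"

definition unitary_mat :: "'d::finite cmat \<Rightarrow> bool" where
  "unitary_mat U \<longleftrightarrow> cadj U ** U = mat 1"

definition hermitian_mat :: "'d::finite cmat \<Rightarrow> bool" where
  "hermitian_mat A \<longleftrightarrow> cadj A = A"

definition density_op :: "'d::finite cmat \<Rightarrow> bool" where
  "density_op \<rho> \<longleftrightarrow> hermitian_mat \<rho> \<and> trace \<rho> = 1 \<and>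
     (\<forall>v :: complex^'d. Im (\<Sum>i\<in>UNIV. cnj (v $ i) * (\<rho> *v v) $ i) = 0 \<and>
                         Re (\<Sum>i\<in>UNIV. cnj (v $ i) * (\<rho> *v v) $ i) \<ge> 0)"

definition proj :: "complex^'d::finite \<Rightarrow> 'd cmat" where
  "proj \<phi> = (\<chi> i j. \<phi> $ i * cnj (\<phi> $ j))"

definition hs_norm :: "'d::finite cmat \<Rightarrow> real" where
  "hs_norm A = sqrt (\<Sum>i\<in>UNIV. \<Sum>j\<in>UNIV. (cmod (A $ i $ j))\<^sup>2)"

definition unitary_ensemble :: "'d::finite cmat measure \<Rightarrow> bool" where
  "unitary_ensemble M \<longleftrightarrow> prob_space M \<and> sets M = sets borel \<and> (AE U in M. unitary_mat U)"

definition haar_measure :: "'d::finite cmat measure \<Rightarrow> bool" where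
  "haar_measure H \<longleftrightarrow> unitary_ensemble H \<and>
     (\<forall>V. unitary_mat V \<longrightarrow> distr H borel (\<lambda>U. V ** U) = H)"

text \<open>t-th moments: expectations of the entries of U^{\<otimes>t} \<otimes> conj(U)^{\<otimes>t}.\<close>
definition moment :: "nat \<Rightarrow> 'd::finite cmat measure \<Rightarrow> (nat \<Rightarrow> 'd) \<Rightarrow> (nat \<Rightarrow> 'd)
    \<Rightarrow> (nat \<Rightarrow> 'd) \<Rightarrow> (nat \<Rightarrow> 'd) \<Rightarrow> complex" where
  "moment t M a b c e =
     (\<integral>U. (\<Prod>k<t. U $ a k $ b k) * (\<Prod>k<t. cnj (U $ c k $ e k)) \<partial>M)"

definition unitary_design :: "nat \<Rightarrow> 'd::finite cmat measure \<Rightarrow> bool" where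
  "unitary_design t M \<longleftrightarrow> unitary_ensemble M \<and>
     (\<exists>H. haar_measure H \<and> (\<forall>a b c e. moment t M a b c e = moment t H a b c e))"

text \<open>Measurement channel M(X) = E_U sum_b <b|U X U^\<dagger>|b> U^\<dagger>|b><b|U.\<close>
definition meas_channel :: "'d::finite cmat measure \<Rightarrow> 'd cmat \<Rightarrow> 'd cmat" where
  "meas_channel M X = (\<chi> i j. \<integral>U. (\<Sum>b\<in>UNIV. (U ** X ** cadj U) $ b $ b * cnj (U $ b $ i) * U $ b $ j) \<partial>M)"

definition meas_channel_inv :: "'d::finite cmat measure \<Rightarrow> 'd cmat \<Rightarrow> 'd cmat" where
  "meas_channel_inv M Obs = (THE Y. meas_channel M Y = Obs)"

definition shadow_est :: "'d::finite cmat measure \<Rightarrow> 'd cmat \<Rightarrow> 'd cmat \<Rightarrow> 'd cmat \<Rightarrow> complex" where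
  "shadow_est M Obs \<rho> U =
     (\<Sum>b\<in>UNIV. (U ** \<rho> ** cadj U) $ b $ b * (U ** meas_channel_inv M Obs ** cadj U) $ b $ b)"

text \<open>V_*(Obs,rho) (a real number; we take the real part of the complex expression).\<close>
definition Vstar_rho :: "'d::finite cmat measure \<Rightarrow> 'd cmat \<Rightarrow> 'd cmat \<Rightarrow> real" where
  "Vstar_rho M Obs \<rho> = Re ((\<integral>U. (shadow_est M Obs \<rho> U)\<^sup>2 \<partial>M) - (trace (Obs ** \<rho>))\<^sup>2)"

text \<open>V_*(Obs) = max over density operators (written as a supremum).\<close>
definition Vstar :: "'d::finite cmat measure \<Rightarrow> 'd cmat \<Rightarrow> real" where
  "Vstar M Obs = (SUP \<rho>\<in>{\<rho>. density_op \<rho>}. Vstar_rho M Obs \<rho>)"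

end

theory Submission
  imports Defs
begin

text \<open>Write \<open>A\<^sup>U = U A U\<^sup>*\<close>. Invariance of the Haar measure under \<open>U \<mapsto> V U\<close>, to first order in \<open>V\<close>,
  says that the expectation of the derivation \<open>[E\<^sub>a\<^sub>b, \<cdot>]\<close> applied to any product of four entries of
  matrices \<open>A\<^sup>U\<close> vanishes; the 4-design property transfers this to the ensemble. Choosing the entries
  suitably and summing over \<open>a\<close> gives a recursion that removes one factor at a time and computes all
  moments \<open>E (A\<^sub>b\<^sub>b B\<^sub>b\<^sub>b C\<^sub>b\<^sub>b D\<^sub>b\<^sub>b)\<close>, so no Weingarten calculus is needed. Applying the same identity
  with \<open>a, b\<close> restricted to the indices different from a fixed one reduces the terms with two
  different outcomes \<open>b \<noteq> b'\<close> to these. The result is, with \<open>\<parallel>\<cdot>\<parallel>\<close> the Hilbert-Schmidt norm,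
  \<open>d (d+2) (d+3) V(O, \<rho>) = (d+1) (((d+2) tr \<rho>\<^sup>2 - 1) \<parallel>O\<parallel>\<^sup>2 - 4 tr \<rho>O\<^sup>2 + 2 (d+1) tr \<rho>\<^sup>2O\<^sup>2 - 2 tr \<rho>O\<rho>O)
  + (d\<^sup>2 + 3 d + 4) (tr \<rho>O)\<^sup>2\<close>.
  The general bound follows by estimating the terms separately; for \<open>O = |\<phi>\<rangle>\<langle>\<phi>| - 1/d\<close> the right hand side
  depends only on \<open>tr \<rho>\<^sup>2\<close>, \<open>\<parallel>\<rho>\<phi>\<parallel>\<^sup>2\<close> and \<open>f = \<langle>\<phi>|\<rho>|\<phi>\<rangle>\<close>, and is maximal when all three are \<open>1\<close> because
  \<open>tr \<rho>\<^sup>2 \<le> 1\<close> and \<open>\<parallel>\<rho>\<phi>\<parallel>\<^sup>2 \<le> f \<le> 1\<close>.\<close>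

section \<open>Conjugation by random unitaries\<close>

definition conj_by :: "'d::finite cmat \<Rightarrow> 'd cmat \<Rightarrow> 'd cmat" where
  "conj_by U A = U ** A ** cadj U"

lemma conj_by_entry:
  "conj_by U A $ x $ y = (\<Sum>i\<in>UNIV. \<Sum>j\<in>UNIV. U $ x $ i * A $ i $ j * cnj (U $ y $ j))"
  unfolding conj_by_def matrix_matrix_mult_def cadj_def
  by (simp add: sum_distrib_right) (rule sum.swap)

lemma cadj_mult: "cadj (A ** B) = cadj B ** cadj A"
  by (simp add: cadj_def matrix_matrix_mult_def vec_eq_iff mult.commute)

lemma cadj_cadj [simp]: "cadj (cadj A) = A"
  by (simp add: cadj_def vec_eq_iff)

lemma cadj_mat_1 [simp]: "cadj (mat 1) = mat 1"
  by (simp add: cadj_def mat_def vec_eq_iff)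

lemma cadj_add: "cadj (A + B) = cadj A + cadj B"
  by (simp add: cadj_def vec_eq_iff)

lemma cadj_scaleR: "cadj (c *\<^sub>R A) = c *\<^sub>R cadj A"
  by (simp add: cadj_def vec_eq_iff)

lemma unitary_matD: "unitary_mat U \<Longrightarrow> cadj U ** U = mat 1"
  by (simp add: unitary_mat_def)

lemma unitary_matD': "unitary_mat U \<Longrightarrow> U ** cadj U = mat 1"
  by (simp add: unitary_mat_def matrix_left_right_inverse)

section \<open>Essentially bounded random variables\<close>

lemma unitary_entry_le_1:
  assumes "unitary_mat U"
  shows "cmod (U $ x $ i) \<le> 1"
proof -
  have "(\<Sum>k\<in>UNIV. U $ x $ k * cnj (U $ x $ k)) = (U ** cadj U) $ x $ x"
    by (simp add: matrix_matrix_mult_def cadj_def)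
  also have "\<dots> = 1" using unitary_matD'[OF assms] by (simp add: mat_def)
  finally have "complex_of_real (\<Sum>k\<in>UNIV. (cmod (U $ x $ k))\<^sup>2) = 1"
    by (simp add: complex_norm_square[symmetric])
  then have "(\<Sum>k\<in>UNIV. (cmod (U $ x $ k))\<^sup>2) = 1"
    using of_real_eq_1_iff by blast
  moreover have "(cmod (U $ x $ i))\<^sup>2 \<le> (\<Sum>k\<in>UNIV. (cmod (U $ x $ k))\<^sup>2)"
    by (rule member_le_sum) auto
  ultimately show ?thesis by (simp add: power_le_one_iff abs_square_le_1)
qed

text \<open>Integrability alone does not pass to products; essential boundedness does, and over a
  probability space it implies integrability. One predicate closed under ring operations thus serves
  every polynomial in the entries. The bound holds only almost everywhere because an ensemble is
  unitary only almost surely.\<close>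

definition bdd_rv :: "'a measure \<Rightarrow> ('a \<Rightarrow> complex) \<Rightarrow> bool" where
  "bdd_rv M F \<longleftrightarrow> F \<in> borel_measurable M \<and> (\<exists>K. AE U in M. norm (F U) \<le> K)"

lemma bdd_rv_const [intro, simp]: "bdd_rv M (\<lambda>_. c)"
  by (auto simp: bdd_rv_def)

lemma bdd_rv_add [intro]:
  assumes "bdd_rv M F" "bdd_rv M G"
  shows "bdd_rv M (\<lambda>U. F U + G U)"
proof -
  from assms obtain K L where K: "AE U in M. norm (F U) \<le> K" and L: "AE U in M. norm (G U) \<le> L"
    by (auto simp: bdd_rv_def)
  have "AE U in M. norm (F U + G U) \<le> K + L"
    using K L by eventually_elim (rule norm_triangle_le, simp)
  then show ?thesis using assms by (auto simp: bdd_rv_def)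
qed

lemma bdd_rv_mult [intro]:
  assumes "bdd_rv M F" "bdd_rv M G"
  shows "bdd_rv M (\<lambda>U. F U * G U)"
proof -
  from assms obtain K L where K: "AE U in M. norm (F U) \<le> K" and L: "AE U in M. norm (G U) \<le> L"
    by (auto simp: bdd_rv_def)
  have "AE U in M. norm (F U * G U) \<le> \<bar>K\<bar> * \<bar>L\<bar>"
    using K L by eventually_elim (simp add: norm_mult, rule mult_mono, auto)
  then show ?thesis using assms by (auto simp: bdd_rv_def)
qed

lemma bdd_rv_uminus [intro]: "bdd_rv M F \<Longrightarrow> bdd_rv M (\<lambda>U. - F U)"
  using bdd_rv_mult[OF bdd_rv_const[of M "-1"], of F] by simp

lemma bdd_rv_diff [intro]: "bdd_rv M F \<Longrightarrow> bdd_rv M G \<Longrightarrow> bdd_rv M (\<lambda>U. F U - G U)"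
  using bdd_rv_add[OF _ bdd_rv_uminus, of M F G] by simp

lemma bdd_rv_sum [intro]: "(\<And>i. i \<in> I \<Longrightarrow> bdd_rv M (F i)) \<Longrightarrow> bdd_rv M (\<lambda>U. \<Sum>i\<in>I. F i U)"
  by (induction I rule: infinite_finite_induct) auto

lemma bdd_rv_prod [intro]: "(\<And>i. i \<in> I \<Longrightarrow> bdd_rv M (F i)) \<Longrightarrow> bdd_rv M (\<lambda>U. \<Prod>i\<in>I. F i U)"
  by (induction I rule: infinite_finite_induct) auto

lemma (in prob_space) bdd_rv_integrable: "bdd_rv M F \<Longrightarrow> integrable M F"
  by (auto simp: bdd_rv_def intro: integrable_const_bound)

lemma unitary_ensemble_prob: "unitary_ensemble M \<Longrightarrow> prob_space M"
  by (simp add: unitary_ensemble_def)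

lemma unitary_ensemble_AE: "unitary_ensemble M \<Longrightarrow> AE U in M. unitary_mat U"
  by (simp add: unitary_ensemble_def)

lemma entry_measurable: "(\<lambda>U :: 'd::finite cmat. U $ x $ i) \<in> borel_measurable borel"
  by (intro borel_measurable_continuous_onI continuous_intros)

lemma bdd_rv_entry:
  assumes "unitary_ensemble M"
  shows "bdd_rv M (\<lambda>U. U $ x $ i)" and "bdd_rv M (\<lambda>U. cnj (U $ x $ i))"
proof -
  have "sets M = sets borel" using assms by (simp add: unitary_ensemble_def)
  then have m: "(\<lambda>U. U $ x $ i) \<in> borel_measurable M"
    using entry_measurable measurable_cong_sets by blast
  moreover have "(\<lambda>U. cnj (U $ x $ i)) \<in> borel_measurable M"
    using measurable_compose[OF m, of cnj] by (simp add: borel_measurable_continuous_onI continuous_on_cnj continuous_on_id)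
  moreover have "AE U in M. cmod (U $ x $ i) \<le> 1"
    using unitary_ensemble_AE[OF assms] by eventually_elim (rule unitary_entry_le_1)
  ultimately show "bdd_rv M (\<lambda>U. U $ x $ i)" "bdd_rv M (\<lambda>U. cnj (U $ x $ i))"
    by (auto simp: bdd_rv_def)
qed

lemma bdd_rv_conj_by:
  assumes "unitary_ensemble M"
  shows "bdd_rv M (\<lambda>U. conj_by U A $ x $ y)"
  unfolding conj_by_entry by (intro bdd_rv_sum bdd_rv_mult bdd_rv_const bdd_rv_entry assms)

section \<open>Polynomials in a real parameter\<close>

lemma polynomial_zero_on_reals:
  fixes c :: "nat \<Rightarrow> complex"
  assumes "\<And>s::real. (\<Sum>j\<le>n. c j * of_real s ^ j) = 0" "j \<le> n"
  shows "c j = 0"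
proof (rule complex_eqI)
  have "(\<Sum>j\<le>n. Re (c j) * s ^ j) = Re (\<Sum>j\<le>n. c j * of_real s ^ j)" for s :: real
    by (simp flip: of_real_power)
  then have "\<forall>s. (\<Sum>j\<le>n. Re (c j) * s ^ j) = 0" using assms by simp
  then have "\<forall>k\<le>n. Re (c k) = 0" by (subst (asm) polyfun_eq_0)
  then show "Re (c j) = Re 0" using assms(2) by auto
  have "(\<Sum>j\<le>n. Im (c j) * s ^ j) = Im (\<Sum>j\<le>n. c j * of_real s ^ j)" for s :: real
    by (simp flip: of_real_power)
  then have "\<forall>s. (\<Sum>j\<le>n. Im (c j) * s ^ j) = 0" using assms by simp
  then have "\<forall>k\<le>n. Im (c k) = 0" by (subst (asm) polyfun_eq_0)
  then show "Im (c j) = Im 0" using assms(2) by auto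
qed

text \<open>By the Cauchy product each coefficient of the product is a polynomial in the
  coefficients of the factors, so boundedness is inherited by induction.\<close>

lemma bdd_rv_coeff_prod:
  assumes "\<And>k j. k \<in> I \<Longrightarrow> bdd_rv M (\<lambda>U. coeff (p k U) j)"
  shows "bdd_rv M (\<lambda>U. coeff (\<Prod>k\<in>I. p k U) j)"
  using assms
proof (induction I arbitrary: j rule: infinite_finite_induct)
  case (insert k I)
  then show ?case by (simp add: coeff_mult) (intro bdd_rv_sum bdd_rv_mult; simp)
qed (auto simp: one_poly.rep_eq coeff_pCons split: nat.splits)

lemma degree_prod_le_bound:
  assumes "\<And>k. k \<in> I \<Longrightarrow> degree (p k) \<le> m"
  shows "degree (\<Prod>k\<in>I. p k) \<le> card I * m"
proof (cases "finite I")
  case True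
  then have "degree (\<Prod>k\<in>I. p k) \<le> (\<Sum>k\<in>I. degree (p k))"
    using degree_prod_sum_le[of I p] by (simp add: comp_def)
  also have "\<dots> \<le> card I * m" using sum_bounded_above[of I "\<lambda>k. degree (p k)" m] assms by simp
  finally show ?thesis .
qed simp

text \<open>The linear coefficient is the derivative at \<open>0\<close>, and the product rule
  yields the sum. It is the algebraic source of the derivation acting on one factor at a
  time.\<close>

lemma coeff_1_prod:
  fixes a b c :: "nat \<Rightarrow> 'a::idom"
  shows "coeff (\<Prod>k\<in>I. [:a k, b k, c k:]) 1 = (\<Sum>k\<in>I. b k * (\<Prod>l\<in>I-{k}. a l))"
proof -
  have "coeff (\<Prod>k\<in>I. [:a k, b k, c k:]) 1 = poly (pderiv (\<Prod>k\<in>I. [:a k, b k, c k:])) 0"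
    by (simp add: poly_0_coeff_0 coeff_pderiv)
  then show ?thesis
    by (simp add: pderiv_prod poly_sum poly_prod pderiv_pCons mult.commute)
qed

section \<open>Invariance identities for the Haar measure\<close>

lemma scaleR_mult_left: "(c *\<^sub>R A) ** B = c *\<^sub>R (A ** (B :: 'd::finite cmat))"
  by (simp add: matrix_matrix_mult_def vec_eq_iff scaleR_sum_right)

lemma scaleR_mult_right: "A ** (c *\<^sub>R B) = c *\<^sub>R (A ** (B :: 'd::finite cmat))"
  by (simp add: matrix_matrix_mult_def vec_eq_iff scaleR_sum_right)

lemma mult_add_left: "(A + B) ** C = A ** C + B ** (C :: 'd::finite cmat)"
  by (simp add: matrix_matrix_mult_def vec_eq_iff sum.distrib algebra_simps)

lemma mult_diff_left: "(A - B) ** C = A ** C - B ** (C :: 'd::finite cmat)"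
  by (simp add: matrix_matrix_mult_def vec_eq_iff sum_subtractf algebra_simps)

lemma mult_diff_right: "A ** (B - C) = A ** B - A ** (C :: 'd::finite cmat)"
  by (simp add: matrix_matrix_mult_def vec_eq_iff sum_subtractf algebra_simps)

lemma mult_uminus_left: "(- A) ** C = - (A ** (C :: 'd::finite cmat))"
  by (simp add: matrix_matrix_mult_def vec_eq_iff sum_negf)

lemma mult_uminus_right: "A ** (- C) = - (A ** (C :: 'd::finite cmat))"
  by (simp add: matrix_matrix_mult_def vec_eq_iff sum_negf)

lemmas cmat_ring_simps = scaleR_mult_left scaleR_mult_right mult_diff_left mult_diff_right
  mult_uminus_left mult_uminus_right mult_add_left matrix_add_ldistrib

lemma conj_by_mult_left: "conj_by (V ** U) A = V ** conj_by U A ** cadj V"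
  by (simp add: conj_by_def cadj_mult matrix_mul_assoc)

text \<open>The rational path \<open>(1 + s K) / sqrt (1 + s\<^sup>2)\<close> of unitaries replaces the one-parameter group
  \<open>exp (t K)\<close>: it makes the averages polynomial in \<open>s\<close>, so no differentiation under the integral
  is needed.\<close>

lemma unitary_path:
  fixes K :: "'d::finite cmat"
  assumes K: "cadj K = - K" "K ** K = - mat 1"
  defines "V \<equiv> \<lambda>s::real. (1 / sqrt (1 + s\<^sup>2)) *\<^sub>R (mat 1 + s *\<^sub>R K)"
  shows "unitary_mat (V s)"
    and "V s ** B ** cadj (V s) =
      (1 / (1 + s\<^sup>2)) *\<^sub>R (B + s *\<^sub>R (K ** B - B ** K) + s\<^sup>2 *\<^sub>R (- (K ** B ** K)))"
proof -
  define \<alpha> where "\<alpha> = 1 / sqrt (1 + s\<^sup>2)"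
  have pos: "1 + s\<^sup>2 > 0" by (simp add: add_pos_nonneg)
  then have \<alpha>: "\<alpha> * \<alpha> = 1 / (1 + s\<^sup>2)" by (simp add: \<alpha>_def)
  have V: "V s = \<alpha> *\<^sub>R (mat 1 + s *\<^sub>R K)" by (simp add: V_def \<alpha>_def)
  have c: "cadj (V s) = \<alpha> *\<^sub>R (mat 1 - s *\<^sub>R K)"
    by (simp add: V cadj_add cadj_scaleR K)
  have "cadj (V s) ** V s = (\<alpha> * \<alpha>) *\<^sub>R ((mat 1 - s *\<^sub>R K) ** (mat 1 + s *\<^sub>R K))"
    unfolding c unfolding V by (simp only: scaleR_mult_left scaleR_mult_right scaleR_scaleR)
  also have "(mat 1 - s *\<^sub>R K) ** (mat 1 + s *\<^sub>R K) = (1 + s\<^sup>2) *\<^sub>R mat 1"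
    by (simp add: cmat_ring_simps K power2_eq_square scaleR_add_left scaleR_add_right)
  finally show "unitary_mat (V s)" using pos by (simp add: unitary_mat_def \<alpha>)
  have "V s ** B ** cadj (V s) = (\<alpha> * \<alpha>) *\<^sub>R ((mat 1 + s *\<^sub>R K) ** B ** (mat 1 - s *\<^sub>R K))"
    unfolding c unfolding V by (simp only: scaleR_mult_left scaleR_mult_right scaleR_scaleR)
  also have "(mat 1 + s *\<^sub>R K) ** B ** (mat 1 - s *\<^sub>R K) =
      B + s *\<^sub>R (K ** B - B ** K) + s\<^sup>2 *\<^sub>R (- (K ** B ** K))"
    by (simp add: cmat_ring_simps power2_eq_square algebra_simps)
  finally show "V s ** B ** cadj (V s) =
      (1 / (1 + s\<^sup>2)) *\<^sub>R (B + s *\<^sub>R (K ** B - B ** K) + s\<^sup>2 *\<^sub>R (- (K ** B ** K)))"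
    unfolding \<alpha> .
qed

lemma haar_integral_invariant:
  fixes F :: "'d::finite cmat \<Rightarrow> complex"
  assumes "haar_measure H" "unitary_mat V" "F \<in> borel_measurable H"
  shows "(\<integral>U. F (V ** U) \<partial>H) = (\<integral>U. F U \<partial>H)"
proof -
  have s: "sets H = sets borel" using assms(1) by (simp add: haar_measure_def unitary_ensemble_def)
  have "continuous_on UNIV (\<lambda>U. V ** U)"
    unfolding matrix_matrix_mult_def by (intro continuous_intros)
  then have m: "(\<lambda>U. V ** U) \<in> measurable H borel"
    using borel_measurable_continuous_onI measurable_cong_sets[OF s refl] by blast
  have "F \<in> borel_measurable borel" using assms(3) measurable_cong_sets[OF s refl] by blast
  then have "(\<integral>U. F U \<partial>(distr H borel (\<lambda>U. V ** U))) = (\<integral>U. F (V ** U) \<partial>H)"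
    by (rule integral_distr[OF m])
  then show ?thesis using assms(1,2) by (simp add: haar_measure_def)
qed

text \<open>Along the path of unitaries the averaged product of entries is a polynomial in
  \<open>s\<close> divided by \<open>(1 + s^2)^t\<close>. By invariance it does not depend on
  \<open>s\<close>, so the polynomial is a constant times \<open>(1 + s^2)^t\<close> and hence even.
  Its odd coefficients vanish, and the coefficient of \<open>s\<close> is the claim.\<close>

lemma haar_stationary_skew:
  fixes K :: "'d::finite cmat" and A :: "nat \<Rightarrow> 'd cmat"
  assumes H: "haar_measure H" and K: "cadj K = - K" "K ** K = - mat 1"
  shows "(\<integral>U. (\<Sum>k<t. (K ** conj_by U (A k) - conj_by U (A k) ** K) $ x k $ y k *
            (\<Prod>l\<in>{..<t}-{k}. conj_by U (A l) $ x l $ y l)) \<partial>H) = 0"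
proof -
  have ens: "unitary_ensemble H" using H by (simp add: haar_measure_def)
  interpret prob_space H using ens by (rule unitary_ensemble_prob)
  \<comment> \<open>Up to the common factor \<open>1 / (1 + s^2)\<close>, the \<open>k\<close>-th
    entry along the path is \<open>a + b s + c s^2\<close>; \<open>p U\<close> is the product of
    these quadratics and \<open>e j\<close> its averaged coefficients.\<close>
  define a where "a k U = conj_by U (A k) $ x k $ y k" for k U
  define b where "b k U = (K ** conj_by U (A k) - conj_by U (A k) ** K) $ x k $ y k" for k U
  define c where "c k U = (- (K ** conj_by U (A k) ** K)) $ x k $ y k" for k U
  define p where "p U = (\<Prod>k<t. [:a k U, b k U, c k U:])" for U
  define e where "e j = (\<integral>U. coeff (p U) j \<partial>H)" for j
  note bdd = bdd_rv_sum bdd_rv_mult bdd_rv_diff bdd_rv_uminus bdd_rv_const bdd_rv_conj_by[OF ens]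
  have bdd_a: "bdd_rv H (a k)" for k
    unfolding a_def by (intro bdd)
  have bdd_b: "bdd_rv H (b k)" for k
    unfolding b_def matrix_matrix_mult_def by simp (intro bdd)
  have bdd_c: "bdd_rv H (c k)" for k
    unfolding c_def matrix_matrix_mult_def by simp (intro bdd)
  have bdd_p: "bdd_rv H (\<lambda>U. coeff (p U) j)" for j
    unfolding p_def
  proof (rule bdd_rv_coeff_prod)
    show "bdd_rv H (\<lambda>U. coeff [:a k U, b k U, c k U:] j)" for k j
    proof -
      have "coeff [:a k U, b k U, c k U:] j =
          (if j = 0 then a k U else if j = 1 then b k U else if j = 2 then c k U else 0)" for U
        by (auto simp: coeff_pCons split: nat.splits)
      then show ?thesis
        by (cases "j = 0"; cases "j = 1"; cases "j = 2"; simp add: bdd_a bdd_b bdd_c)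
    qed
  qed
  have deg: "degree (p U) \<le> t * 2" for U
    unfolding p_def using degree_prod_le_bound[of "{..<t}" "\<lambda>k. [:a k U, b k U, c k U:]" 2] by simp
  have poly_p: "poly (p U) z = (\<Sum>j\<le>t*2. coeff (p U) j * z ^ j)" for U z
    unfolding poly_altdef using deg[of U]
    by (intro sum.mono_neutral_left) (auto simp: coeff_eq_0)
  have ev: "(\<Sum>j\<le>t*2. e j * of_real s ^ j) = (1 + s\<^sup>2) ^ t *\<^sub>R (\<integral>U. (\<Prod>k<t. a k U) \<partial>H)" for s :: real
  proof -
    define V where "V = (1 / sqrt (1 + s\<^sup>2)) *\<^sub>R (mat 1 + s *\<^sub>R K)"
    have pos: "1 + s\<^sup>2 > 0" by (simp add: add_pos_nonneg)
    have "a k (V ** U) = (1 / (1 + s\<^sup>2)) *\<^sub>R poly [:a k U, b k U, c k U:] (of_real s)" for k U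
      unfolding a_def b_def c_def conj_by_mult_left V_def unitary_path(2)[OF K]
      by (simp only: vector_scaleR_component vector_add_component vector_minus_component vector_uminus_component)
         (simp add: scaleR_conv_of_real power2_eq_square algebra_simps)
    then have "(\<Prod>k<t. a k (V ** U)) = (1 / (1 + s\<^sup>2)) ^ t *\<^sub>R poly (p U) (of_real s)" for U
      by (simp add: p_def poly_prod scaleR_conv_of_real prod_dividef power_divide)
    then have "(1 + s\<^sup>2) ^ t *\<^sub>R (\<Prod>k<t. a k (V ** U)) = poly (p U) (of_real s)" for U
      using pos by (simp add: power_divide)
    then have "(\<integral>U. poly (p U) (of_real s) \<partial>H) = (1 + s\<^sup>2) ^ t *\<^sub>R (\<integral>U. (\<Prod>k<t. a k (V ** U)) \<partial>H)"
      by (simp flip: integral_scaleR_right)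
    also have "(\<integral>U. (\<Prod>k<t. a k (V ** U)) \<partial>H) = (\<integral>U. (\<Prod>k<t. a k U) \<partial>H)"
    proof (rule haar_integral_invariant[OF H])
      show "unitary_mat V" unfolding V_def by (rule unitary_path(1)[OF K])
      have "bdd_rv H (\<lambda>U. \<Prod>k<t. a k U)" by (intro bdd_rv_prod bdd_a)
      then show "(\<lambda>U. \<Prod>k<t. a k U) \<in> borel_measurable H" by (simp add: bdd_rv_def)
    qed
    also have "(\<integral>U. poly (p U) (of_real s) \<partial>H) = (\<Sum>j\<le>t*2. e j * of_real s ^ j)"
      unfolding poly_p e_def
      by (subst Bochner_Integration.integral_sum) (auto intro!: bdd_rv_integrable bdd_p)
    finally show ?thesis .
  qed
  \<comment> \<open>The weight \<open>1 - (-1)^j\<close> is \<open>2\<close> for odd and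
    \<open>0\<close> for even \<open>j\<close>: subtracting the values at \<open>s\<close> and
    \<open>-s\<close> isolates the odd coefficients.\<close>
  have "(\<Sum>j\<le>t*2. (e j * (1 - (-1) ^ j)) * of_real s ^ j) = 0" for s :: real
  proof -
    have "(\<Sum>j\<le>t*2. (e j * (1 - (-1) ^ j)) * of_real s ^ j)
        = (\<Sum>j\<le>t*2. e j * of_real s ^ j) - (\<Sum>j\<le>t*2. e j * of_real (-s) ^ j)"
      by (subst sum_subtractf[symmetric], rule sum.cong[OF refl])
         (simp add: power_minus[of "complex_of_real s"] algebra_simps)
    also have "\<dots> = 0" unfolding ev by simp
    finally show ?thesis .
  qed
  note odd = polynomial_zero_on_reals[OF this]
  \<comment> \<open>Index \<open>1\<close> is within the degree bound \<open>t*2\<close> only for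
    positive \<open>t\<close>; for \<open>t = 0\<close> the polynomial is the constant
    \<open>1\<close>.\<close>
  have "e 1 = 0"
  proof (cases "t = 0")
    case True
    then show ?thesis by (simp add: e_def p_def)
  next
    case False
    then show ?thesis using odd[of 1] by simp
  qed
  then show ?thesis
    unfolding e_def p_def coeff_1_prod a_def b_def by simp
qed

section \<open>From skew matrices to matrix units\<close>

lemma sesquilinear_zero:
  fixes q :: "'d::finite \<Rightarrow> 'd \<Rightarrow> complex"
  assumes "\<And>v :: complex^'d. (\<Sum>a\<in>UNIV. \<Sum>b\<in>UNIV. v $ a * cnj (v $ b) * q a b) = 0"
  shows "q a b = 0"
proof -
  define Q where "Q u v = (\<Sum>a\<in>UNIV. \<Sum>b\<in>UNIV. u $ a * cnj (v $ b) * q a b)" for u v :: "complex^'d"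
  have add: "Q (u + u') v = Q u v + Q u' v" "Q u (v + v') = Q u v + Q u v'" for u u' v v'
    by (simp_all add: Q_def algebra_simps sum.distrib)
  have scl: "Q (c *s u) v = c * Q u v" "Q u (c *s v) = cnj c * Q u v" for c u v
    by (simp_all add: Q_def sum_distrib_left algebra_simps)
  have z: "Q v v = 0" for v using assms by (simp add: Q_def)
  have "Q u v = 0" for u v
  proof -
    \<comment> \<open>Polarization over the complex numbers: the vectors \<open>u + v\<close> and
      \<open>u + \<i> *s v\<close> give two independent relations between \<open>Q u v\<close> and
      \<open>Q v u\<close>.\<close>
    have 1: "Q u v + Q v u = 0" using z[of "u + v"] unfolding add by (simp add: z add.commute)
    have 2: "- \<i> * Q u v + \<i> * Q v u = 0" using z[of "u + \<i> *s v"] unfolding add scl by (simp add: z add.commute)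
    have "2 * Q u v = (Q u v + Q v u) + \<i> * (- \<i> * Q u v + \<i> * Q v u)"
      by (simp add: algebra_simps)
    then show ?thesis unfolding 1 2 by simp
  qed
  moreover have "Q (axis a 1) (axis b 1) = q a b"
  proof -
    have "Q (axis a 1) (axis b 1) = (\<Sum>a'\<in>UNIV. \<Sum>b'\<in>UNIV. if a' = a then if b' = b then q a' b' else 0 else 0)"
      unfolding Q_def by (intro sum.cong refl) (auto simp: axis_def)
    also have "\<dots> = q a b" by (simp add: if_distrib[of "\<lambda>f. sum f UNIV"] sum.If_cases)
    finally show ?thesis .
  qed
  ultimately show ?thesis by simp
qed

text \<open>The path of unitaries exists only for skew \<open>K\<close> with square
  \<open>-1\<close>, but the identity is linear in \<open>K\<close>. The complex span of these
  matrices contains all rank-one matrices \<open>v v^*\<close>, and \<open>sesquilinear_zero\<close>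
  does the rest.\<close>

lemma skew_involutions_span:
  fixes q :: "'d::finite \<Rightarrow> 'd \<Rightarrow> complex"
  assumes "\<And>K :: 'd cmat. cadj K = - K \<Longrightarrow> K ** K = - mat 1 \<Longrightarrow>
    (\<Sum>a\<in>UNIV. \<Sum>b\<in>UNIV. K $ a $ b * q a b) = 0"
  shows "q a b = 0"
proof (rule sesquilinear_zero)
  fix v :: "complex^'d"
  define N where "N = (\<Sum>k\<in>UNIV. v $ k * cnj (v $ k))"
  show "(\<Sum>a\<in>UNIV. \<Sum>b\<in>UNIV. v $ a * cnj (v $ b) * q a b) = 0"
  proof (cases "v = 0")
    case False
    have "N = complex_of_real (\<Sum>k\<in>UNIV. (cmod (v $ k))\<^sup>2)"
      by (simp add: N_def complex_norm_square[symmetric])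
    moreover have "(\<Sum>k\<in>UNIV. (cmod (v $ k))\<^sup>2) \<noteq> 0"
      using False by (subst sum_nonneg_eq_0_iff) (auto simp: vec_eq_iff)
    ultimately have N: "N \<noteq> 0" "cnj N = N"
      by (metis of_real_eq_0_iff, metis complex_cnj_complex_of_real)
    \<comment> \<open>With \<open>P = v v^* / N\<close> the projection onto the line of
      \<open>v\<close>, these are \<open>K = i (2 P - 1)\<close> and \<open>I = i\<close>. Both are
      skew with square \<open>-1\<close>, and \<open>K + I = 2 i P\<close>.\<close>
    define K :: "'d cmat" where "K = (\<chi> a b. \<i> * (2 / N * (v $ a * cnj (v $ b)) - (if a = b then 1 else 0)))"
    define I :: "'d cmat" where "I = (\<chi> a b. \<i> * (if a = b then 1 else 0))"
    have "(\<Sum>a\<in>UNIV. \<Sum>b\<in>UNIV. I $ a $ b * q a b) = 0"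
    proof (rule assms)
      show "cadj I = - I" by (simp add: I_def cadj_def vec_eq_iff)
      have "(I ** I) $ a $ b = (\<Sum>k\<in>UNIV. if k = a then if a = b then -1 else 0 else 0)" for a b
        unfolding I_def matrix_matrix_mult_def vec_lambda_beta by (intro sum.cong refl) auto
      then show "I ** I = - mat 1" by (simp add: vec_eq_iff mat_def)
    qed
    moreover have "(\<Sum>a\<in>UNIV. \<Sum>b\<in>UNIV. K $ a $ b * q a b) = 0"
    proof (rule assms)
      show "cadj K = - K" by (simp add: K_def cadj_def vec_eq_iff N algebra_simps)
      have "(K ** K) $ a $ b = (- mat 1) $ a $ b" for a b
      proof -
        have "(K ** K) $ a $ b = - (\<Sum>k\<in>UNIV.
          (2 / N * (v $ a * cnj (v $ k)) - (if a = k then 1 else 0)) *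
          (2 / N * (v $ k * cnj (v $ b)) - (if k = b then 1 else 0)))"
          by (simp add: K_def matrix_matrix_mult_def sum_negf[symmetric] algebra_simps)
        also have "(\<Sum>k\<in>UNIV.
          (2 / N * (v $ a * cnj (v $ k)) - (if a = k then 1 else 0)) *
          (2 / N * (v $ k * cnj (v $ b)) - (if k = b then 1 else 0)))
          = (\<Sum>k\<in>UNIV. (4 / N^2 * v $ a * cnj (v $ b)) * (v $ k * cnj (v $ k))
              - (if k = b then 2 / N * (v $ a * cnj (v $ k)) else 0)
              - (if k = a then 2 / N * (v $ k * cnj (v $ b)) else 0)
              + (if k = a then if k = b then 1 else 0 else 0))"
          by (rule sum.cong[OF refl]) (auto simp: algebra_simps power2_eq_square)
        also have "\<dots> = (4 / N^2 * v $ a * cnj (v $ b)) * N - 2 / N * (v $ a * cnj (v $ b))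
          - 2 / N * (v $ a * cnj (v $ b)) + (if a = b then 1 else 0)"
          by (simp only: sum.distrib sum_subtractf sum_distrib_left[symmetric] N_def[symmetric]) simp
        also have "\<dots> = (if a = b then 1 else 0)"
          using N by (simp add: power2_eq_square field_simps)
        finally show ?thesis by (simp add: mat_def)
      qed
      then show "K ** K = - mat 1" by (simp add: vec_eq_iff)
    qed
    moreover have "(\<Sum>a\<in>UNIV. \<Sum>b\<in>UNIV. v $ a * cnj (v $ b) * q a b) =
      N / (2 * \<i>) * ((\<Sum>a\<in>UNIV. \<Sum>b\<in>UNIV. K $ a $ b * q a b) + (\<Sum>a\<in>UNIV. \<Sum>b\<in>UNIV. I $ a $ b * q a b))"
      unfolding sum.distrib[symmetric] sum_distrib_left
      by (intro sum.cong refl) (use N in \<open>simp add: K_def I_def field_simps\<close>)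
    ultimately show ?thesis by simp
  qed simp
qed

text \<open>The \<open>(x, y)\<close> entry of the commutator \<open>[E\<^sub>a\<^sub>b, B]\<close> with a matrix unit.\<close>
definition comm_unit :: "'d \<Rightarrow> 'd \<Rightarrow> 'd::finite cmat \<Rightarrow> 'd \<Rightarrow> 'd \<Rightarrow> complex" where
  "comm_unit a b B x y = (if x = a then B $ b $ y else 0) - (if y = b then B $ x $ a else 0)"

lemma commutator_entry:
  "(K ** B - B ** K) $ x $ y = (\<Sum>a\<in>UNIV. \<Sum>b\<in>UNIV. K $ a $ b * comm_unit a b B x y)"
proof -
  have "(\<Sum>a\<in>UNIV. \<Sum>b\<in>UNIV. K $ a $ b * comm_unit a b B x y)
    = (\<Sum>a\<in>UNIV. \<Sum>b\<in>UNIV. if x = a then K $ a $ b * B $ b $ y else 0)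
    - (\<Sum>a\<in>UNIV. \<Sum>b\<in>UNIV. if y = b then B $ x $ a * K $ a $ b else 0)"
    unfolding sum_subtractf[symmetric] comm_unit_def
    by (intro sum.cong refl) (auto simp: algebra_simps)
  also have "(\<Sum>a\<in>UNIV. \<Sum>b\<in>UNIV. if x = a then K $ a $ b * B $ b $ y else 0) = (K ** B) $ x $ y"
    by (subst sum.swap) (simp add: matrix_matrix_mult_def)
  also have "(\<Sum>a\<in>UNIV. \<Sum>b\<in>UNIV. if y = b then B $ x $ a * K $ a $ b else 0) = (B ** K) $ x $ y"
    by (simp add: matrix_matrix_mult_def)
  finally show ?thesis by simp
qed

lemma bdd_rv_comm_unit:
  assumes "unitary_ensemble M"
  shows "bdd_rv M (\<lambda>U. comm_unit a b (conj_by U A) x y)"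
proof -
  have "bdd_rv M (\<lambda>U. if P then conj_by U A $ x $ y else 0)" for P x y
    by (cases P) (simp_all add: bdd_rv_conj_by assms)
  then show ?thesis unfolding comm_unit_def by (intro bdd_rv_diff)
qed

text \<open>Expanding the commutator with \<open>K\<close> in matrix units makes
  \<open>haar_stationary_skew\<close> a linear relation in the entries of \<open>K\<close>, so each
  coefficient vanishes by \<open>skew_involutions_span\<close>. A matrix unit itself need not be
  skew.\<close>

lemma haar_stationary:
  fixes A :: "nat \<Rightarrow> 'd::finite cmat"
  assumes H: "haar_measure H"
  shows "(\<integral>U. (\<Sum>k<t. comm_unit a b (conj_by U (A k)) (x k) (y k) *
            (\<Prod>l\<in>{..<t}-{k}. conj_by U (A l) $ x l $ y l)) \<partial>H) = 0"
proof -
  define F where "F a b U = (\<Sum>k<t. comm_unit a b (conj_by U (A k)) (x k) (y k) *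
            (\<Prod>l\<in>{..<t}-{k}. conj_by U (A l) $ x l $ y l))" for a b U
  have ens: "unitary_ensemble H" using H by (simp add: haar_measure_def)
  interpret prob_space H using ens by (rule unitary_ensemble_prob)
  have int: "integrable H (F a b)" for a b
    unfolding F_def
    by (intro bdd_rv_integrable bdd_rv_sum bdd_rv_mult bdd_rv_prod bdd_rv_conj_by bdd_rv_comm_unit ens)
  have "(\<integral>U. F a b U \<partial>H) = 0"
  proof (rule skew_involutions_span)
    fix K :: "'d cmat" assume K: "cadj K = - K" "K ** K = - mat 1"
    have "(\<Sum>k<t. (K ** conj_by U (A k) - conj_by U (A k) ** K) $ x k $ y k *
            (\<Prod>l\<in>{..<t}-{k}. conj_by U (A l) $ x l $ y l))
          = (\<Sum>a\<in>UNIV. \<Sum>b\<in>UNIV. K $ a $ b * F a b U)" for U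
      unfolding commutator_entry F_def sum_distrib_left sum_distrib_right
      by (subst sum.swap, rule sum.cong[OF refl], subst sum.swap) (simp add: mult.assoc)
    then have "0 = (\<integral>U. (\<Sum>a\<in>UNIV. \<Sum>b\<in>UNIV. K $ a $ b * F a b U) \<partial>H)"
      using haar_stationary_skew[OF H K, where t = t and A = A and x = x and y = y] by simp
    also have "\<dots> = (\<Sum>a\<in>UNIV. \<Sum>b\<in>UNIV. K $ a $ b * (\<integral>U. F a b U \<partial>H))"
      by (simp add: Bochner_Integration.integral_sum int)
    finally show "(\<Sum>a\<in>UNIV. \<Sum>b\<in>UNIV. K $ a $ b * (\<integral>U. F a b U \<partial>H)) = 0" by simp
  qed
  then show ?thesis by (simp add: F_def)
qed

section \<open>Moments of 4-designs\<close>

text \<open>Expanding the product chooses an index pair \<open>g k\<close> for each factor. Every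
  term then has exactly \<open>t\<close> entries of \<open>U\<close> and \<open>t\<close> conjugated
  ones, so the ensemble enters only through its \<open>t\<close>-th moments.\<close>

lemma integral_prod_conj_by:
  assumes "unitary_ensemble M"
  shows "(\<integral>U. (\<Prod>k<t. conj_by U (A k) $ x k $ y k) \<partial>M) =
    (\<Sum>g\<in>{..<t} \<rightarrow>\<^sub>E UNIV. (\<Prod>k<t. A k $ fst (g k) $ snd (g k)) *
       moment t M x (\<lambda>k. fst (g k)) y (\<lambda>k. snd (g k)))"
proof -
  interpret prob_space M using assms by (rule unitary_ensemble_prob)
  have "(\<Prod>k<t. conj_by U (A k) $ x k $ y k) =
      (\<Sum>g\<in>{..<t} \<rightarrow>\<^sub>E UNIV. (\<Prod>k<t. A k $ fst (g k) $ snd (g k)) *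
        ((\<Prod>k<t. U $ x k $ fst (g k)) * (\<Prod>k<t. cnj (U $ y k $ snd (g k)))))" for U
  proof -
    have "(\<Prod>k<t. conj_by U (A k) $ x k $ y k) =
        (\<Prod>k<t. \<Sum>p\<in>UNIV. U $ x k $ fst p * A k $ fst p $ snd p * cnj (U $ y k $ snd p))"
      by (simp add: conj_by_entry sum.cartesian_product case_prod_beta)
    also have "\<dots> = (\<Sum>g\<in>{..<t} \<rightarrow>\<^sub>E UNIV. \<Prod>k<t.
        U $ x k $ fst (g k) * A k $ fst (g k) $ snd (g k) * cnj (U $ y k $ snd (g k)))"
      by (rule prod_sum_PiE) auto
    finally show ?thesis by (simp add: prod.distrib mult_ac)
  qed
  moreover have "integrable M (\<lambda>U. (\<Prod>k<t. A k $ fst (g k) $ snd (g k)) *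
        ((\<Prod>k<t. U $ x k $ fst (g k)) * (\<Prod>k<t. cnj (U $ y k $ snd (g k)))))" for g
    by (intro bdd_rv_integrable bdd_rv_mult bdd_rv_prod bdd_rv_const bdd_rv_entry assms)
  ultimately show ?thesis
    by (simp add: Bochner_Integration.integral_sum moment_def)
qed

lemma design_stationary:
  fixes A :: "nat \<Rightarrow> 'd::finite cmat"
  assumes M: "unitary_design t M"
  shows "(\<integral>U. (\<Sum>k<t. comm_unit a b (conj_by U (A k)) (x k) (y k) *
            (\<Prod>l\<in>{..<t}-{k}. conj_by U (A l) $ x l $ y l)) \<partial>M) = 0"
proof -
  obtain H where H: "haar_measure H" and mom: "\<And>a b c e. moment t M a b c e = moment t H a b c e"
    using M by (auto simp: unitary_design_def)
  define P where "P x y U = (\<Prod>l<t. conj_by U (A l) $ x l $ y l)" for x y and U :: "'d cmat"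
  define F where "F U = (\<Sum>k<t. comm_unit a b (conj_by U (A k)) (x k) (y k) *
            (\<Prod>l\<in>{..<t}-{k}. conj_by U (A l) $ x l $ y l))" for U
  \<comment> \<open>A matrix unit only replaces a row index \<open>a\<close> by \<open>b\<close> or
    a column index \<open>b\<close> by \<open>a\<close>. The integrand is therefore a combination of
    products of \<open>t\<close> entries, whose averages agree for the design and the Haar
    measure.\<close>
  have F: "F U = (\<Sum>k<t. of_bool (x k = a) * P (x(k := b)) y U - of_bool (y k = b) * P x (y(k := a)) U)" for U
    unfolding F_def
  proof (rule sum.cong[OF refl])
    fix k assume k: "k \<in> {..<t}"
    have "P (x(k := b)) y U = conj_by U (A k) $ b $ y k * (\<Prod>l\<in>{..<t}-{k}. conj_by U (A l) $ x l $ y l)"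
      unfolding P_def using k by (subst prod.remove[of _ k]) auto
    moreover have "P x (y(k := a)) U = conj_by U (A k) $ x k $ a * (\<Prod>l\<in>{..<t}-{k}. conj_by U (A l) $ x l $ y l)"
      unfolding P_def using k by (subst prod.remove[of _ k]) auto
    ultimately show "comm_unit a b (conj_by U (A k)) (x k) (y k) *
            (\<Prod>l\<in>{..<t}-{k}. conj_by U (A l) $ x l $ y l) =
        of_bool (x k = a) * P (x(k := b)) y U - of_bool (y k = b) * P x (y(k := a)) U"
      by (simp add: comm_unit_def algebra_simps)
  qed
  have int: "(\<integral>U. F U \<partial>N) = (\<Sum>k<t. of_bool (x k = a) * (\<integral>U. P (x(k := b)) y U \<partial>N)
      - of_bool (y k = b) * (\<integral>U. P x (y(k := a)) U \<partial>N))" if "unitary_ensemble N" for N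
  proof -
    interpret prob_space N using that by (rule unitary_ensemble_prob)
    have "integrable N (P x y)" for x y
      unfolding P_def by (intro bdd_rv_integrable bdd_rv_prod bdd_rv_conj_by that)
    then show ?thesis unfolding F by (simp add: Bochner_Integration.integral_sum)
  qed
  have ens: "unitary_ensemble M" "unitary_ensemble H"
    using M H by (auto simp: unitary_design_def haar_measure_def)
  have "(\<integral>U. P x y U \<partial>M) = (\<integral>U. P x y U \<partial>H)" for x y
    unfolding P_def by (simp add: integral_prod_conj_by ens mom)
  then have "(\<integral>U. F U \<partial>M) = (\<integral>U. F U \<partial>H)"
    by (simp add: int ens)
  also have "\<dots> = 0" unfolding F_def by (rule haar_stationary[OF H])
  finally show ?thesis unfolding F_def .
qed

lemma conj_by_mult:
  assumes "unitary_mat U"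
  shows "conj_by U A ** conj_by U B = conj_by U (A ** B)"
proof -
  have "conj_by U A ** conj_by U B = U ** A ** (cadj U ** U) ** B ** cadj U"
    by (simp add: conj_by_def matrix_mul_assoc)
  then show ?thesis using unitary_matD[OF assms] by (simp add: conj_by_def matrix_mul_assoc)
qed

lemma trace_conj_by:
  assumes "unitary_mat U"
  shows "trace (conj_by U A) = trace A"
  unfolding conj_by_def
  by (subst trace_mul_sym) (simp add: matrix_mul_assoc unitary_matD[OF assms])

lemma conj_by_mat_1: "unitary_mat U \<Longrightarrow> conj_by U (mat 1) = mat 1"
  by (simp add: conj_by_def unitary_matD')

text \<open>Contracting over \<open>x\<close> turns entrywise identities into matrix ones: here a
  trace appears, in \<open>sum_comm_unit_mult\<close> a matrix product.\<close>

lemma sum_comm_unit_same: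
  "(\<Sum>x\<in>UNIV. comm_unit x b C x b) = of_nat CARD('d) * C $ b $ b - trace (C :: 'd::finite cmat)"
  by (simp add: comm_unit_def sum_subtractf trace_def)

lemma sum_comm_unit_mult:
  "(\<Sum>x\<in>UNIV. C $ x $ b * comm_unit x b A b b) = C $ b $ b * A $ b $ b - (A ** C) $ b $ b"
  by (simp add: comm_unit_def sum_subtractf right_diff_distrib matrix_matrix_mult_def
      if_distrib[of "\<lambda>z. _ * z"] mult.commute cong: if_cong)

section \<open>Recursion for the moments of one diagonal entry\<close>

locale design4 =
  fixes M :: "'d::finite cmat measure"
  assumes design: "unitary_design 4 M"
begin

lemma ensemble: "unitary_ensemble M"
  using design by (simp add: unitary_design_def)

sublocale prob_space M
  using ensemble by (rule unitary_ensemble_prob)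

lemmas bdd_rules = bdd_rv_sum bdd_rv_mult bdd_rv_prod bdd_rv_add bdd_rv_diff bdd_rv_uminus bdd_rv_const
  bdd_rv_conj_by[OF ensemble] bdd_rv_comm_unit[OF ensemble] bdd_rv_entry[OF ensemble]

lemma AE_unitary: "AE U in M. unitary_mat U"
  using ensemble by (rule unitary_ensemble_AE)

lemma integral_cong_unitary:
  fixes F :: "'d cmat \<Rightarrow> complex"
  assumes "bdd_rv M F" "bdd_rv M G" "\<And>U. unitary_mat U \<Longrightarrow> F U = G U"
  shows "(\<integral>U. F U \<partial>M) = (\<integral>U. G U \<partial>M)"
  by (rule integral_cong_AE)
     (use assms AE_unitary in \<open>auto simp: bdd_rv_def elim: eventually_mono\<close>)

lemma stationary4:
  "(\<integral>U. comm_unit a b (conj_by U A) x1 y1 *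
      (conj_by U B $ x2 $ y2 * conj_by U C $ x3 $ y3 * conj_by U D $ x4 $ y4)
    + comm_unit a b (conj_by U B) x2 y2 *
      (conj_by U A $ x1 $ y1 * conj_by U C $ x3 $ y3 * conj_by U D $ x4 $ y4)
    + comm_unit a b (conj_by U C) x3 y3 *
      (conj_by U A $ x1 $ y1 * conj_by U B $ x2 $ y2 * conj_by U D $ x4 $ y4)
    + comm_unit a b (conj_by U D) x4 y4 *
      (conj_by U A $ x1 $ y1 * conj_by U B $ x2 $ y2 * conj_by U C $ x3 $ y3) \<partial>M) = 0"
proof -
  have s: "{..<4} = {0, 1, 2, 3::nat}" by auto
  show ?thesis
    using design_stationary[OF design, of a b "\<lambda>k. [A, B, C, D] ! k"
      "\<lambda>k. [x1, x2, x3, x4] ! k" "\<lambda>k. [y1, y2, y3, y4] ! k"]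
    unfolding s by (simp add: insert_Diff_if numeral_2_eq_2 numeral_3_eq_3 add.assoc mult.assoc)
qed

text \<open>An argument \<open>mat 1\<close> contributes the factor \<open>1\<close> almost surely,
  so this one function also covers the moments of lower degree.\<close>

definition m4 :: "'d \<Rightarrow> 'd cmat \<Rightarrow> 'd cmat \<Rightarrow> 'd cmat \<Rightarrow> 'd cmat \<Rightarrow> complex" where
  "m4 b A B C D = (\<integral>U. conj_by U A $ b $ b * conj_by U B $ b $ b * conj_by U C $ b $ b * conj_by U D $ b $ b \<partial>M)"

lemma m4_swap: "m4 b A B C D = m4 b A C B D"
  by (simp add: m4_def mult_ac)

lemma m4_one: "m4 b (mat 1) (mat 1) (mat 1) (mat 1) = 1"
proof -
  have "m4 b (mat 1) (mat 1) (mat 1) (mat 1) = (\<integral>U. 1 \<partial>M)"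
    unfolding m4_def
    by (rule integral_cong_unitary) (intro bdd_rules, rule bdd_rules, simp add: conj_by_mat_1, simp add: mat_def)
  then show ?thesis by (simp add: prob_space)
qed

text \<open>Stationarity under the matrix unit \<open>E_xb\<close> is applied to entry
  \<open>(x, b)\<close> of \<open>C\<close> and entry \<open>(b, b)\<close> of the others, then
  summed over \<open>x\<close>. Acting on \<open>C\<close> it gives \<open>d C_bb - tr C\<close>;
  acting on each of the other three it gives \<open>C_bb A_bb - (A C)_bb\<close>. Hence the factor
  \<open>d + 3\<close>; the place vacated by \<open>C\<close> is filled with
  \<open>mat 1\<close>.\<close>

lemma m4_recursion:
  "(of_nat CARD('d) + 3) * m4 b C A1 A2 A3 =
    trace C * m4 b (mat 1) A1 A2 A3 + m4 b (mat 1) (A1 ** C) A2 A3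
    + m4 b (mat 1) A1 (A2 ** C) A3 + m4 b (mat 1) A1 A2 (A3 ** C)"
proof -
  let ?e = "\<lambda>A U. conj_by U A $ b $ b"
  let ?f = "\<lambda>x U. comm_unit x b (conj_by U C) x b * (?e A1 U * ?e A2 U * ?e A3 U)
    + comm_unit x b (conj_by U A1) b b * (conj_by U C $ x $ b * ?e A2 U * ?e A3 U)
    + comm_unit x b (conj_by U A2) b b * (conj_by U C $ x $ b * ?e A1 U * ?e A3 U)
    + comm_unit x b (conj_by U A3) b b * (conj_by U C $ x $ b * ?e A1 U * ?e A2 U)"
  let ?g = "\<lambda>U. (of_nat CARD('d) + 3) * (?e C U * ?e A1 U * ?e A2 U * ?e A3 U)
     - trace C * (?e (mat 1) U * ?e A1 U * ?e A2 U * ?e A3 U)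
     - ?e (mat 1) U * ?e (A1 ** C) U * ?e A2 U * ?e A3 U
     - ?e (mat 1) U * ?e A1 U * ?e (A2 ** C) U * ?e A3 U
     - ?e (mat 1) U * ?e A1 U * ?e A2 U * ?e (A3 ** C) U"
  have "(\<integral>U. (\<Sum>x\<in>UNIV. ?f x U) \<partial>M) = (\<Sum>x\<in>UNIV. (\<integral>U. ?f x U \<partial>M))"
    by (rule Bochner_Integration.integral_sum) (intro bdd_rv_integrable bdd_rules)
  also have "\<dots> = 0" by (simp only: stationary4) simp
  finally have "(\<integral>U. (\<Sum>x\<in>UNIV. ?f x U) \<partial>M) = 0" .
  moreover have "(\<integral>U. (\<Sum>x\<in>UNIV. ?f x U) \<partial>M) = (\<integral>U. ?g U \<partial>M)"
  proof (rule integral_cong_unitary)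
    fix U :: "'d cmat" assume U: "unitary_mat U"
    have "(\<Sum>x\<in>UNIV. ?f x U) = (\<Sum>x\<in>UNIV. comm_unit x b (conj_by U C) x b) * (?e A1 U * ?e A2 U * ?e A3 U)
     + (\<Sum>x\<in>UNIV. conj_by U C $ x $ b * comm_unit x b (conj_by U A1) b b) * (?e A2 U * ?e A3 U)
     + (\<Sum>x\<in>UNIV. conj_by U C $ x $ b * comm_unit x b (conj_by U A2) b b) * (?e A1 U * ?e A3 U)
     + (\<Sum>x\<in>UNIV. conj_by U C $ x $ b * comm_unit x b (conj_by U A3) b b) * (?e A1 U * ?e A2 U)"
      by (simp add: sum.distrib sum_distrib_left sum_distrib_right mult_ac)
    also have "\<dots> = ?g U"
      unfolding sum_comm_unit_same sum_comm_unit_mult conj_by_mult[OF U] trace_conj_by[OF U] conj_by_mat_1[OF U]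
      by (simp add: mat_def algebra_simps)
    finally show "(\<Sum>x\<in>UNIV. ?f x U) = ?g U" .
  qed (intro bdd_rules)+
  moreover have "(\<integral>U. ?g U \<partial>M) = (of_nat CARD('d) + 3) * m4 b C A1 A2 A3
    - trace C * m4 b (mat 1) A1 A2 A3 - m4 b (mat 1) (A1 ** C) A2 A3
    - m4 b (mat 1) A1 (A2 ** C) A3 - m4 b (mat 1) A1 A2 (A3 ** C)"
  proof -
    have i: "integrable M (\<lambda>U. ?e A U * ?e B U * ?e C U * ?e D U)" for A B C D
      by (intro bdd_rv_integrable bdd_rules)
    show ?thesis unfolding m4_def by (simp add: i)
  qed
  ultimately show ?thesis by (simp add: algebra_simps)
qed

end

section \<open>Closed forms of the diagonal moments\<close>

lemma of_nat_add_neq_0: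
  "of_nat CARD('d::finite) + (numeral k :: complex) \<noteq> 0"
  "of_nat CARD('d) + (1 :: complex) \<noteq> 0"
  "of_nat CARD('d) \<noteq> (0 :: complex)"
proof -
  have "of_nat (CARD('d) + numeral k) \<noteq> (0 :: complex)" "of_nat (CARD('d) + 1) \<noteq> (0 :: complex)"
    by (simp_all only: of_nat_eq_0_iff) simp_all
  then show "of_nat CARD('d) + (numeral k :: complex) \<noteq> 0" "of_nat CARD('d) + (1 :: complex) \<noteq> 0"
    by (simp_all only: of_nat_add of_nat_numeral of_nat_1 not_False_eq_True)
qed simp

lemma eq_divide_mult:
  fixes z :: complex
  assumes "z * m = N / k" "z \<noteq> 0"
  shows "m = N / (k * z)"
proof -
  have "m = (N / k) / z" by (rule eq_divide_imp) (simp_all add: assms flip: assms(1))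
  then show ?thesis by simp
qed

text \<open>Cyclicity of the trace, arranged as rewrite rules with one normal form for each cyclic
  word. \<open>R R Y Y\<close> and \<open>R Y R Y\<close> are different cyclic words and stay
  separate.\<close>

lemma trace_words:
  fixes R Y :: "'d::finite cmat"
  shows "trace (Y ** R) = trace (R ** Y)" "trace (Y ** Y ** R) = trace (R ** Y ** Y)"
    "trace (Y ** R ** Y) = trace (R ** Y ** Y)" "trace (Y ** R ** R) = trace (R ** R ** Y)"
    "trace (R ** Y ** R) = trace (R ** R ** Y)"
    "trace (Y ** Y ** R ** R) = trace (R ** R ** Y ** Y)"
    "trace (Y ** R ** R ** Y) = trace (R ** R ** Y ** Y)"
    "trace (R ** Y ** Y ** R) = trace (R ** R ** Y ** Y)"
    "trace (Y ** R ** Y ** R) = trace (R ** Y ** R ** Y)"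
proof -
  have 1: "trace (A ** B ** C) = trace (C ** A ** B)" for A B C :: "'d cmat"
    using trace_mul_sym[of "A ** B" C] by (simp add: matrix_mul_assoc)
  have 2: "trace (A ** B ** C ** D) = trace (D ** A ** B ** C)" for A B C D :: "'d cmat"
    using trace_mul_sym[of "A ** B ** C" D] by (simp add: matrix_mul_assoc)
  show "trace (Y ** R) = trace (R ** Y)" by (rule trace_mul_sym)
  show "trace (Y ** Y ** R) = trace (R ** Y ** Y)" by (rule 1)
  show "trace (Y ** R ** Y) = trace (R ** Y ** Y)" by (rule 1[symmetric])
  show "trace (Y ** R ** R) = trace (R ** R ** Y)" by (rule 1[symmetric])
  show "trace (R ** Y ** R) = trace (R ** R ** Y)" by (rule 1)
  show "trace (Y ** Y ** R ** R) = trace (R ** R ** Y ** Y)" using 2[of Y Y R R] 2[of R Y Y R] by simp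
  show "trace (Y ** R ** R ** Y) = trace (R ** R ** Y ** Y)" by (rule 2[symmetric])
  show "trace (R ** Y ** Y ** R) = trace (R ** R ** Y ** Y)" by (rule 2)
  show "trace (Y ** R ** Y ** R) = trace (R ** Y ** R ** Y)" by (rule 2)
qed

context design4
begin

text \<open>Three terms on the right of the recursion are again the wanted moment; cancelling them
  reduces \<open>d + 3\<close> to \<open>d\<close>. In \<open>m2\<close> two terms cancel and in
  \<open>m3\<close> one, which gives the factors \<open>d + 1\<close> and
  \<open>d + 2\<close>.\<close>

lemma m1: "of_nat CARD('d) * m4 b (mat 1) (mat 1) (mat 1) A = trace A"
proof -
  have "(of_nat CARD('d) + 3) * m4 b A (mat 1) (mat 1) (mat 1) = trace A
      + m4 b (mat 1) A (mat 1) (mat 1) + m4 b (mat 1) (mat 1) A (mat 1) + m4 b (mat 1) (mat 1) (mat 1) A"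
    using m4_recursion[of b A "mat 1" "mat 1" "mat 1"] by (simp add: m4_one)
  moreover have "m4 b A (mat 1) (mat 1) (mat 1) = m4 b (mat 1) (mat 1) (mat 1) A"
    "m4 b (mat 1) A (mat 1) (mat 1) = m4 b (mat 1) (mat 1) (mat 1) A"
    "m4 b (mat 1) (mat 1) A (mat 1) = m4 b (mat 1) (mat 1) (mat 1) A"
    by (simp_all add: m4_def mult_ac)
  ultimately show ?thesis by (simp add: algebra_simps)
qed

lemma m2: "(of_nat CARD('d) + 1) * m4 b (mat 1) (mat 1) A B
    = trace A * m4 b (mat 1) (mat 1) (mat 1) B + m4 b (mat 1) (mat 1) (mat 1) (B ** A)"
proof -
  have "(of_nat CARD('d) + 3) * m4 b A B (mat 1) (mat 1) = trace A * m4 b (mat 1) B (mat 1) (mat 1)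
      + m4 b (mat 1) (B ** A) (mat 1) (mat 1) + m4 b (mat 1) B A (mat 1) + m4 b (mat 1) B (mat 1) A"
    using m4_recursion[of b A B "mat 1" "mat 1"] by simp
  moreover have "m4 b A B (mat 1) (mat 1) = m4 b (mat 1) (mat 1) A B"
    "m4 b (mat 1) B A (mat 1) = m4 b (mat 1) (mat 1) A B"
    "m4 b (mat 1) B (mat 1) A = m4 b (mat 1) (mat 1) A B"
    "m4 b (mat 1) B (mat 1) (mat 1) = m4 b (mat 1) (mat 1) (mat 1) B" for B
    by (simp_all add: m4_def mult_ac)
  ultimately show ?thesis by (simp add: algebra_simps)
qed

lemma m3: "(of_nat CARD('d) + 2) * m4 b (mat 1) A B C
    = trace A * m4 b (mat 1) (mat 1) B C + m4 b (mat 1) (mat 1) (B ** A) C + m4 b (mat 1) (mat 1) B (C ** A)"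
proof -
  have "(of_nat CARD('d) + 3) * m4 b A B C (mat 1) = trace A * m4 b (mat 1) B C (mat 1)
      + m4 b (mat 1) (B ** A) C (mat 1) + m4 b (mat 1) B (C ** A) (mat 1) + m4 b (mat 1) B C A"
    using m4_recursion[of b A B C "mat 1"] by simp
  moreover have "m4 b A B C (mat 1) = m4 b (mat 1) A B C"
    "m4 b (mat 1) B C A = m4 b (mat 1) A B C"
    by (simp_all add: m4_def mult_ac)
  moreover have "m4 b (mat 1) B C (mat 1) = m4 b (mat 1) (mat 1) B C" for B C
    by (simp add: m4_def mult_ac)
  ultimately show ?thesis by (simp add: algebra_simps)
qed

lemma m1_closed: "m4 b (mat 1) (mat 1) (mat 1) A = trace A / of_nat CARD('d)"
  using m1[of b A] of_nat_add_neq_0(3)[where 'd = 'd] by (simp add: field_simps)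

lemma m2_closed: "m4 b (mat 1) (mat 1) A B =
    (trace A * trace B + trace (B ** A)) / (of_nat CARD('d) * (of_nat CARD('d) + 1))"
  by (rule eq_divide_mult) (simp_all add: m2 m1_closed add_divide_distrib of_nat_add_neq_0)

lemma m3_closed: "m4 b (mat 1) A B C = (trace A * (trace B * trace C + trace (C ** B))
    + trace (B ** A) * trace C + trace (C ** B ** A) + trace B * trace (C ** A) + trace (C ** A ** B))
    / (of_nat CARD('d) * (of_nat CARD('d) + 1) * (of_nat CARD('d) + 2))"
  by (rule eq_divide_mult)
     (simp_all add: m3 m2_closed matrix_mul_assoc add_divide_distrib distrib_left of_nat_add_neq_0)

text \<open>A last recursion step removes one \<open>R\<close> and leaves only third moments.
  \<open>R\<close> stands for the state, \<open>Y\<close> for the inverse channel applied to the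
  observable.\<close>

lemma m4_closed:
  assumes "trace R = 1" "trace Y = 0"
  shows "m4 b R R Y Y = (trace (Y ** Y) * (1 + trace (R ** R)) + 4 * trace (R ** Y ** Y)
     + 2 * (trace (R ** Y))\<^sup>2 + 4 * trace (R ** R ** Y ** Y) + 2 * trace (R ** Y ** R ** Y))
     / (of_nat CARD('d) * (of_nat CARD('d) + 1) * (of_nat CARD('d) + 2) * (of_nat CARD('d) + 3))"
proof -
  note c = trace_words[where Y = Y and R = R]
  have "(of_nat CARD('d) + 3) * m4 b R R Y Y = m4 b (mat 1) R Y Y + m4 b (mat 1) (R ** R) Y Y
     + m4 b (mat 1) R (Y ** R) Y + m4 b (mat 1) R Y (Y ** R)"
    using m4_recursion[of b R R Y Y] assms by simp
  also have "\<dots> = (trace (Y ** Y) * (1 + trace (R ** R)) + 4 * trace (R ** Y ** Y)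
     + 2 * (trace (R ** Y))\<^sup>2 + 4 * trace (R ** R ** Y ** Y) + 2 * trace (R ** Y ** R ** Y))
     / (of_nat CARD('d) * (of_nat CARD('d) + 1) * (of_nat CARD('d) + 2))"
    unfolding m3_closed add_divide_distrib[symmetric]
    by (simp add: assms c matrix_mul_assoc power2_eq_square algebra_simps)
  finally show ?thesis by (rule eq_divide_mult) (rule of_nat_add_neq_0)
qed

end

section \<open>Contributions of two different outcomes\<close>

lemma sum_punctured_square:
  fixes C D :: "'d::finite cmat"
  shows "(\<Sum>y\<in>UNIV-{b}. \<Sum>x\<in>UNIV-{b}. D $ y $ x * C $ x $ y) =
    trace (D ** C) - (D ** C) $ b $ b - (C ** D) $ b $ b + D $ b $ b * C $ b $ b"
proof -
  have "(\<Sum>y\<in>UNIV-{b}. \<Sum>x\<in>UNIV-{b}. D $ y $ x * C $ x $ y)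
      = (\<Sum>y\<in>UNIV-{b}. (D ** C) $ y $ y - D $ y $ b * C $ b $ y)"
    by (simp add: matrix_matrix_mult_def sum_diff1)
  also have "\<dots> = trace (D ** C) - (D ** C) $ b $ b - ((C ** D) $ b $ b - D $ b $ b * C $ b $ b)"
    by (simp add: sum_subtractf sum_diff1 trace_def matrix_matrix_mult_def mult.commute)
  finally show ?thesis by simp
qed

text \<open>This contracts the action of \<open>E_xy\<close> on the product \<open>C_xy D_yy\<close>
  over the indices other than \<open>b\<close>. The factor \<open>d\<close> consists of
  \<open>d - 1\<close> choices of \<open>x\<close> and one further copy from the case
  \<open>x = y\<close>.\<close>

lemma sum_comm_unit_punctured:
  fixes C D :: "'d::finite cmat"
  shows "(\<Sum>y\<in>UNIV-{b}. \<Sum>x\<in>UNIV-{b}. comm_unit x y C x y * D $ y $ y + comm_unit x y D y y * C $ x $ y) =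
    of_nat CARD('d) * (\<Sum>y\<in>UNIV-{b}. C $ y $ y * D $ y $ y)
    - (trace C - C $ b $ b) * (trace D - D $ b $ b)
    - (trace (D ** C) - (D ** C) $ b $ b - (C ** D) $ b $ b + D $ b $ b * C $ b $ b)"
proof -
  have card: "of_nat (card (UNIV - {b})) = of_nat CARD('d) - (1 :: complex)"
    by (simp add: card_Diff_singleton of_nat_diff)
  have tr: "(\<Sum>x\<in>UNIV-{b}. A $ x $ x) = trace A - A $ b $ b" for A :: "'d cmat"
    by (simp add: trace_def sum_diff1)
  have "(\<Sum>x\<in>UNIV-{b}. comm_unit x y C x y * D $ y $ y + comm_unit x y D y y * C $ x $ y)
      = of_nat CARD('d) * (C $ y $ y * D $ y $ y) - (trace C - C $ b $ b) * D $ y $ y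
        - (\<Sum>x\<in>UNIV-{b}. D $ y $ x * C $ x $ y)" if y: "y \<in> UNIV-{b}" for y
  proof -
    have "(\<Sum>x\<in>UNIV-{b}. comm_unit x y C x y * D $ y $ y + comm_unit x y D y y * C $ x $ y)
      = (\<Sum>x\<in>UNIV-{b}. C $ y $ y * D $ y $ y - C $ x $ x * D $ y $ y
          + (if y = x then D $ y $ y * C $ y $ y else 0) - D $ y $ x * C $ x $ y)"
      by (rule sum.cong[OF refl]) (auto simp: comm_unit_def algebra_simps)
    also have "\<dots> = (of_nat CARD('d) - 1) * (C $ y $ y * D $ y $ y) - (trace C - C $ b $ b) * D $ y $ y
        + D $ y $ y * C $ y $ y - (\<Sum>x\<in>UNIV-{b}. D $ y $ x * C $ x $ y)"
      using y by (simp only: sum.distrib sum_subtractf sum_distrib_right[symmetric] tr sum_constant card)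
                 (simp add: sum.delta')
    finally show ?thesis by (simp add: algebra_simps)
  qed
  then have "(\<Sum>y\<in>UNIV-{b}. \<Sum>x\<in>UNIV-{b}. comm_unit x y C x y * D $ y $ y + comm_unit x y D y y * C $ x $ y)
    = (\<Sum>y\<in>UNIV-{b}. of_nat CARD('d) * (C $ y $ y * D $ y $ y) - (trace C - C $ b $ b) * D $ y $ y
        - (\<Sum>x\<in>UNIV-{b}. D $ y $ x * C $ x $ y))"
    by (rule sum.cong[OF refl])
  also have "\<dots> = of_nat CARD('d) * (\<Sum>y\<in>UNIV-{b}. C $ y $ y * D $ y $ y)
    - (trace C - C $ b $ b) * (trace D - D $ b $ b)
    - (\<Sum>y\<in>UNIV-{b}. \<Sum>x\<in>UNIV-{b}. D $ y $ x * C $ x $ y)"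
    by (simp only: sum_subtractf sum_distrib_left[symmetric] tr)
  finally show ?thesis by (simp only: sum_punctured_square)
qed

context design4
begin

text \<open>Commuting with \<open>E_xy\<close> for \<open>x\<close> and \<open>y\<close> different
  from \<open>b\<close> does not affect the entry \<open>(b, b)\<close>, so the factors of
  \<open>A\<close> and \<open>B\<close> behave as constants. By
  \<open>sum_comm_unit_punctured\<close> everything except the wanted sum involves the single
  outcome \<open>b\<close>.\<close>

lemma off_diagonal_moment:
  "of_nat CARD('d) * (\<integral>U. conj_by U A $ b $ b * conj_by U B $ b $ b *
        (\<Sum>y\<in>UNIV-{b}. conj_by U C $ y $ y * conj_by U D $ y $ y) \<partial>M) =
    (trace C * trace D + trace (D ** C)) * m4 b (mat 1) (mat 1) A B
    - trace C * m4 b (mat 1) A B D - trace D * m4 b (mat 1) A B C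
    - m4 b (mat 1) A B (D ** C) - m4 b (mat 1) A B (C ** D) + 2 * m4 b A B C D"
proof -
  let ?e = "\<lambda>A U. conj_by U A $ b $ b"
  let ?f = "\<lambda>y x U. comm_unit x y (conj_by U C) x y * (conj_by U D $ y $ y * ?e A U * ?e B U)
    + comm_unit x y (conj_by U D) y y * (conj_by U C $ x $ y * ?e A U * ?e B U)
    + comm_unit x y (conj_by U A) b b * (conj_by U C $ x $ y * conj_by U D $ y $ y * ?e B U)
    + comm_unit x y (conj_by U B) b b * (conj_by U C $ x $ y * conj_by U D $ y $ y * ?e A U)"
  let ?S = "\<lambda>U. ?e A U * ?e B U * (\<Sum>y\<in>UNIV-{b}. conj_by U C $ y $ y * conj_by U D $ y $ y)"
  let ?h = "\<lambda>U. (trace C * trace D + trace (D ** C)) * (?e (mat 1) U * ?e (mat 1) U * ?e A U * ?e B U)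
    - trace C * (?e (mat 1) U * ?e A U * ?e B U * ?e D U) - trace D * (?e (mat 1) U * ?e A U * ?e B U * ?e C U)
    - ?e (mat 1) U * ?e A U * ?e B U * ?e (D ** C) U - ?e (mat 1) U * ?e A U * ?e B U * ?e (C ** D) U
    + 2 * (?e A U * ?e B U * ?e C U * ?e D U)"
  have "(\<integral>U. (\<Sum>y\<in>UNIV-{b}. \<Sum>x\<in>UNIV-{b}. ?f y x U) \<partial>M)
      = (\<Sum>y\<in>UNIV-{b}. \<Sum>x\<in>UNIV-{b}. (\<integral>U. ?f y x U \<partial>M))"
    by (subst Bochner_Integration.integral_sum, (intro bdd_rv_integrable bdd_rules)[1])
       (intro sum.cong refl Bochner_Integration.integral_sum bdd_rv_integrable bdd_rules)
  also have "\<dots> = 0" by (simp only: stationary4) simp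
  finally have "(\<integral>U. (\<Sum>y\<in>UNIV-{b}. \<Sum>x\<in>UNIV-{b}. ?f y x U) \<partial>M) = 0" .
  moreover have "(\<integral>U. (\<Sum>y\<in>UNIV-{b}. \<Sum>x\<in>UNIV-{b}. ?f y x U) \<partial>M) = (\<integral>U. of_nat CARD('d) * ?S U - ?h U \<partial>M)"
  proof (rule integral_cong_unitary)
    fix U :: "'d cmat" assume U: "unitary_mat U"
    have "(\<Sum>y\<in>UNIV-{b}. \<Sum>x\<in>UNIV-{b}. ?f y x U) =
      (\<Sum>y\<in>UNIV-{b}. \<Sum>x\<in>UNIV-{b}. ?e A U * ?e B U *
        (comm_unit x y (conj_by U C) x y * conj_by U D $ y $ y + comm_unit x y (conj_by U D) y y * conj_by U C $ x $ y))"
      by (intro sum.cong refl) (auto simp: comm_unit_def algebra_simps)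
    also have "\<dots> = of_nat CARD('d) * ?S U - ?h U"
      unfolding sum_distrib_left[symmetric] sum_comm_unit_punctured
        conj_by_mult[OF U] trace_conj_by[OF U] conj_by_mat_1[OF U]
      by (simp add: mat_def algebra_simps)
    finally show "(\<Sum>y\<in>UNIV-{b}. \<Sum>x\<in>UNIV-{b}. ?f y x U) = of_nat CARD('d) * ?S U - ?h U" .
  qed (intro bdd_rules)+
  moreover have "(\<integral>U. of_nat CARD('d) * ?S U - ?h U \<partial>M) = of_nat CARD('d) * (\<integral>U. ?S U \<partial>M) -
    ((trace C * trace D + trace (D ** C)) * m4 b (mat 1) (mat 1) A B
    - trace C * m4 b (mat 1) A B D - trace D * m4 b (mat 1) A B C
    - m4 b (mat 1) A B (D ** C) - m4 b (mat 1) A B (C ** D) + 2 * m4 b A B C D)"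
  proof -
    have i: "integrable M (\<lambda>U. ?e A U * ?e B U * ?e C U * ?e D U)" for A B C D
      by (intro bdd_rv_integrable bdd_rules)
    have "integrable M ?S"
      by (intro bdd_rv_integrable bdd_rules)
    then show ?thesis unfolding m4_def by (simp add: i)
  qed
  ultimately show ?thesis by simp
qed

text \<open>The square splits into pairs of equal outcomes, given by \<open>m4_closed\<close>, and
  of different ones, given by \<open>off_diagonal_moment\<close>. Every \<open>b\<close> contributes
  the same share \<open>?V / d\<close>.\<close>

lemma second_moment:
  assumes "trace R = 1" "trace Y = 0"
  shows "(\<integral>U. (\<Sum>b\<in>UNIV. conj_by U R $ b $ b * conj_by U Y $ b $ b)\<^sup>2 \<partial>M) =
    (((of_nat CARD('d) + 2) * trace (R ** R) - 1) * trace (Y ** Y) - 4 * trace (R ** Y ** Y)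
     + (of_nat CARD('d) + 1) * (of_nat CARD('d) + 4) * (trace (R ** Y))\<^sup>2 + 2 * (of_nat CARD('d) + 1) * trace (R ** R ** Y ** Y)
     - 2 * trace (R ** Y ** R ** Y)) / (of_nat CARD('d) * (of_nat CARD('d) + 1) * (of_nat CARD('d) + 2) * (of_nat CARD('d) + 3))" (is "?I = ?V")
proof -
  let ?g = "\<lambda>b U. conj_by U R $ b $ b * conj_by U Y $ b $ b"
  let ?S = "\<lambda>b U. ?g b U * (\<Sum>y\<in>UNIV-{b}. ?g y U)"
  note c = trace_words[where Y = Y and R = R]
  let ?d = "of_nat CARD('d) :: complex"
  have nz: "?d \<noteq> 0" "?d + 1 \<noteq> 0" "?d + 2 \<noteq> 0" "?d + 3 \<noteq> 0"
    by (rule of_nat_add_neq_0)+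
  \<comment> \<open>A common denominator of all the moments involved: multiplied by it, the claim
    becomes a polynomial identity in \<open>d\<close> and the traces.\<close>
  define K where "K = ?d * (?d + 1) * (?d + 2) * (?d + 3)"
  have K: "K \<noteq> 0" using nz by (simp add: K_def)
  have "(\<Sum>b\<in>UNIV. ?g b U)\<^sup>2 = (\<Sum>b\<in>UNIV. ?g b U * ?g b U + ?S b U)" for U
  proof -
    have "?g b U * (\<Sum>y\<in>UNIV. ?g y U) = ?g b U * ?g b U + ?S b U" for b
      by (subst sum.remove[of UNIV b]) (simp_all only: finite UNIV_I distrib_left)
    then show ?thesis by (simp only: power2_eq_square sum_distrib_right)
  qed
  then have "?I = (\<Sum>b\<in>UNIV. (\<integral>U. ?g b U * ?g b U + ?S b U \<partial>M))"
    by (simp only:) (intro Bochner_Integration.integral_sum bdd_rv_integrable bdd_rules)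
  moreover have "(\<integral>U. ?g b U * ?g b U + ?S b U \<partial>M) = ?V / of_nat CARD('d)" for b
  proof -
    have i: "integrable M (\<lambda>U. ?g b U * ?g b U)" "integrable M (?S b)"
      by (intro bdd_rv_integrable bdd_rules)+
    have "(\<integral>U. ?g b U * ?g b U + ?S b U \<partial>M) = (\<integral>U. ?g b U * ?g b U \<partial>M) + (\<integral>U. ?S b U \<partial>M)"
      by (rule Bochner_Integration.integral_add[OF i])
    moreover have "(\<integral>U. ?g b U * ?g b U \<partial>M) = m4 b R R Y Y"
      by (simp add: m4_def mult_ac)
    moreover have "of_nat CARD('d) * (\<integral>U. ?S b U \<partial>M) = trace (Y ** R) * m4 b (mat 1) (mat 1) R Y
       - m4 b (mat 1) R Y Y - m4 b (mat 1) R Y (Y ** R) - m4 b (mat 1) R Y (R ** Y) + 2 * m4 b R R Y Y"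
      using off_diagonal_moment[where b = b and A = R and B = Y and C = R and D = Y] assms m4_swap[of b R Y R Y] by simp
    ultimately have "of_nat CARD('d) * (\<integral>U. ?g b U * ?g b U + ?S b U \<partial>M) = trace (Y ** R) * m4 b (mat 1) (mat 1) R Y
       - m4 b (mat 1) R Y Y - m4 b (mat 1) R Y (Y ** R) - m4 b (mat 1) R Y (R ** Y) + (of_nat CARD('d) + 2) * m4 b R R Y Y"
      by (simp add: algebra_simps)
    also have "\<dots> = ?V"
    proof -
      let ?t = "trace (R ** Y)" and ?a = "trace (R ** Y ** Y)" and ?c = "trace (R ** R ** Y ** Y)"
        and ?e = "trace (R ** Y ** R ** Y)" and ?N = "trace (Y ** Y)" and ?r = "trace (R ** R)"
      have k2: "K * m4 b (mat 1) (mat 1) R Y = (?d + 2) * (?d + 3) * ?t"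
        unfolding m2_closed K_def using nz by (simp add: assms c)
      have k3: "K * m4 b (mat 1) R Y Y = (?d + 3) * (?N + 2 * ?a)"
        "K * m4 b (mat 1) R Y (Y ** R) = (?d + 3) * (?a + ?t\<^sup>2 + ?c + ?e)"
        "K * m4 b (mat 1) R Y (R ** Y) = (?d + 3) * (?a + ?t\<^sup>2 + ?c + ?e)"
        unfolding m3_closed K_def using nz
        by (simp_all add: assms c matrix_mul_assoc power2_eq_square add_ac)
      have k4: "K * m4 b R R Y Y = ?N * (1 + ?r) + 4 * ?a + 2 * ?t\<^sup>2 + 4 * ?c + 2 * ?e"
        unfolding m4_closed[OF assms] K_def using nz by simp
      have "K * (trace (Y ** R) * m4 b (mat 1) (mat 1) R Y
         - m4 b (mat 1) R Y Y - m4 b (mat 1) R Y (Y ** R) - m4 b (mat 1) R Y (R ** Y) + (?d + 2) * m4 b R R Y Y)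
        = ?t * (K * m4 b (mat 1) (mat 1) R Y) - K * m4 b (mat 1) R Y Y
         - K * m4 b (mat 1) R Y (Y ** R) - K * m4 b (mat 1) R Y (R ** Y) + (?d + 2) * (K * m4 b R R Y Y)"
        by (simp add: c algebra_simps)
      also have "\<dots> = ((?d + 2) * ?r - 1) * ?N - 4 * ?a + (?d + 1) * (?d + 4) * ?t\<^sup>2
          + 2 * (?d + 1) * ?c - 2 * ?e"
        unfolding k2 k3 k4 by (simp add: power2_eq_square algebra_simps)
      finally show ?thesis
        unfolding K_def[symmetric] using K by (metis nonzero_mult_div_cancel_left)
    qed
    finally have "of_nat CARD('d) * (\<integral>U. ?g b U * ?g b U + ?S b U \<partial>M) = ?V" .
    then have "(\<integral>U. ?g b U * ?g b U + ?S b U \<partial>M) * of_nat CARD('d) = ?V"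
      by (simp only: mult.commute)
    then show ?thesis by (rule eq_divide_imp[OF nz(1)])
  qed
  ultimately have "?I = (\<Sum>b\<in>(UNIV :: 'd set). ?V / of_nat CARD('d))" by (simp only:)
  moreover have "(\<Sum>b\<in>(UNIV :: 'd set). z / of_nat CARD('d)) = z" for z :: complex
    using nz(1) by simp
  ultimately show ?thesis by (simp only:)
qed

end

section \<open>The variance formula\<close>

lemma trace_scaleR: "trace (c *\<^sub>R A) = of_real c * trace (A :: 'd::finite cmat)"
  unfolding trace_def vector_scaleR_component by (simp only: scaleR_conv_of_real sum_distrib_left)

lemma cnj_trace: "cnj (trace A) = trace (cadj A)"
  by (simp add: trace_def cadj_def)

lemma Im_trace_hermitian_mult:
  assumes "hermitian_mat A" "hermitian_mat B"
  shows "Im (trace (A ** B)) = 0"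
proof -
  have "cnj (trace (A ** B)) = trace (A ** B)"
    unfolding cnj_trace cadj_mult using assms unfolding hermitian_mat_def by (metis trace_mul_sym)
  then have "Im (cnj (trace (A ** B))) = Im (trace (A ** B))" by (rule arg_cong)
  then show ?thesis by simp
qed

context design4
begin

text \<open>The weight \<open>cnj (U $ b $ i) * U $ b $ j\<close> is the diagonal entry at
  \<open>b\<close> of the conjugate of \<open>E\<close>, the matrix unit with its \<open>1\<close>
  at \<open>(j, i)\<close>. The integrand is thus a sum of products of two diagonal entries, and
  \<open>m2_closed\<close> applies.\<close>

lemma meas_channel_entry:
  "meas_channel M X $ i $ j = (X $ i $ j + (if i = j then trace X else 0)) / (of_nat CARD('d) + 1)"
proof -
  define E :: "'d cmat" where "E = (\<chi> a c. if a = j then if c = i then 1 else 0 else 0)"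
  let ?d = "of_nat CARD('d) :: complex"
  have trE: "trace E = (if i = j then 1 else 0)"
    by (simp add: trace_def E_def)
  have EX: "(E ** X) $ a $ a = (if a = j then X $ i $ a else 0)" for a
  proof -
    have "(E ** X) $ a $ a = (\<Sum>k\<in>UNIV. if k = i then if a = j then X $ k $ a else 0 else 0)"
      unfolding matrix_matrix_mult_def E_def vec_lambda_beta by (intro sum.cong refl) auto
    then show ?thesis by simp
  qed
  have trEX: "trace (E ** X) = X $ i $ j"
    by (simp add: trace_def EX)
  have "meas_channel M X $ i $ j = (\<integral>U. (\<Sum>b\<in>UNIV. conj_by U X $ b $ b * conj_by U E $ b $ b) \<partial>M)"
  proof -
    have "conj_by U E $ b $ b = cnj (U $ b $ i) * U $ b $ j" for U b
    proof -
      have "conj_by U E $ b $ b = (\<Sum>a\<in>UNIV. \<Sum>c\<in>UNIV. if c = i then if a = j then U $ b $ a * cnj (U $ b $ c) else 0 else 0)"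
        unfolding conj_by_entry E_def by (intro sum.cong refl) auto
      then show ?thesis by (simp add: mult.commute)
    qed
    then show ?thesis
      by (simp add: meas_channel_def conj_by_def[symmetric] mult.assoc)
  qed
  also have "\<dots> = (\<Sum>b\<in>UNIV. (\<integral>U. conj_by U X $ b $ b * conj_by U E $ b $ b \<partial>M))"
    by (intro Bochner_Integration.integral_sum bdd_rv_integrable bdd_rules)
  also have "\<dots> = (\<Sum>b\<in>UNIV. m4 b (mat 1) (mat 1) X E)"
  proof (rule sum.cong[OF refl])
    fix b
    show "(\<integral>U. conj_by U X $ b $ b * conj_by U E $ b $ b \<partial>M) = m4 b (mat 1) (mat 1) X E"
      unfolding m4_def
      by (rule integral_cong_unitary) ((intro bdd_rules)+, simp add: conj_by_mat_1, simp add: mat_def)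
  qed
  also have "\<dots> = ?d * ((trace X * trace E + trace (E ** X)) / (?d * (?d + 1)))"
    by (simp only: m2_closed sum_constant)
  also have "\<dots> = (X $ i $ j + (if i = j then trace X else 0)) / (?d + 1)"
    by (simp add: trE trEX)
  finally show ?thesis .
qed

lemma meas_channel_inv_traceless:
  assumes "trace Obs = 0"
  shows "meas_channel_inv M Obs = (real CARD('d) + 1) *\<^sub>R Obs"
  unfolding meas_channel_inv_def
proof (rule the_equality)
  have nz: "of_nat CARD('d) + 1 \<noteq> (0 :: complex)" by (rule of_nat_add_neq_0)
  show "meas_channel M ((real CARD('d) + 1) *\<^sub>R Obs) = Obs"
    using nz unfolding vec_eq_iff meas_channel_entry trace_scaleR assms vector_scaleR_component
    by (simp add: scaleR_conv_of_real)
  \<comment> \<open>Uniqueness, as required by \<open>THE\<close>: comparing traces forces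
    \<open>trace Y = 0\<close>, after which the entries of \<open>Y\<close> are determined.\<close>
  fix Y assume Y: "meas_channel M Y = Obs"
  have e: "(of_nat CARD('d) + 1) * Obs $ i $ j = Y $ i $ j + (if i = j then trace Y else 0)" for i j
    using nz unfolding Y[symmetric] meas_channel_entry by simp
  have "(\<Sum>i\<in>UNIV. (of_nat CARD('d) + 1) * Obs $ i $ i) = trace Y + of_nat CARD('d) * trace Y"
    unfolding e by (simp add: sum.distrib trace_def)
  moreover have "(\<Sum>i\<in>UNIV. (of_nat CARD('d) + 1) * Obs $ i $ i) = 0"
    using assms unfolding trace_def by (simp only: sum_distrib_left[symmetric] mult_zero_right)
  ultimately have "(of_nat CARD('d) + 1) * trace Y = 0" by (simp add: algebra_simps)
  then have "trace Y = 0" using nz by simp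
  then have "Y $ i $ j = ((real CARD('d) + 1) *\<^sub>R Obs) $ i $ j" for i j
    using e[of i j] by (simp only: vector_scaleR_component) (simp add: scaleR_conv_of_real)
  then show "Y = (real CARD('d) + 1) *\<^sub>R Obs" by (simp add: vec_eq_iff)
qed

text \<open>On traceless observables the inverse channel is multiplication by \<open>D + 1\<close>.
  The second moment is quadratic in its result, so \<open>(D + 1)^2\<close> comes out and one factor
  cancels against the denominator.\<close>

lemma Vstar_rho_formula:
  fixes Obs R :: "'d cmat"
  assumes "hermitian_mat Obs" "trace Obs = 0" "hermitian_mat R" "trace R = 1"
  defines "D \<equiv> real CARD('d)"
  shows "Vstar_rho M Obs R = ((D + 1) * (((D + 2) * Re (trace (R ** R)) - 1) * Re (trace (Obs ** Obs))
      - 4 * Re (trace (R ** Obs ** Obs)) + 2 * (D + 1) * Re (trace (R ** R ** Obs ** Obs))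
      - 2 * Re (trace (R ** Obs ** R ** Obs)))
      + (D\<^sup>2 + 3 * D + 4) * (Re (trace (R ** Obs)))\<^sup>2) / (D * (D + 2) * (D + 3))"
proof -
  let ?Y = "(D + 1) *\<^sub>R Obs"
  define r N t a c e where "r = trace (R ** R)" and "N = trace (Obs ** Obs)" and "t = trace (R ** Obs)"
    and "a = trace (R ** Obs ** Obs)" and "c = trace (R ** R ** Obs ** Obs)" and "e = trace (R ** Obs ** R ** Obs)"
  note defs = this
  \<comment> \<open>These three traces occur in products, so they must be real for \<open>Re\<close>
    to distribute; \<open>a\<close>, \<open>c\<close> and \<open>e\<close> occur linearly with real
    coefficients.\<close>
  have im: "Im r = 0" "Im N = 0" "Im t = 0"
    unfolding defs by (intro Im_trace_hermitian_mult assms)+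
  have D: "D > 0" by (simp add: D_def)
  have dD: "of_nat CARD('d) = complex_of_real D" by (simp add: D_def)
  define W where "W = ((D + 2) * r - 1) * N - 4 * a + (D + 1) * (D + 4) * t\<^sup>2 + 2 * (D + 1) * c - 2 * e"
  have sm: "(\<integral>U. (shadow_est M Obs R U)\<^sup>2 \<partial>M) =
     (((of_real D + 2) * r - 1) * trace (?Y ** ?Y) - 4 * trace (R ** ?Y ** ?Y)
     + (of_real D + 1) * (of_real D + 4) * (trace (R ** ?Y))\<^sup>2 + 2 * (of_real D + 1) * trace (R ** R ** ?Y ** ?Y)
     - 2 * trace (R ** ?Y ** R ** ?Y)) / (of_real D * (of_real D + 1) * (of_real D + 2) * (of_real D + 3))"
  proof -
    have "trace ?Y = 0" by (simp add: trace_scaleR assms(2))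
    note second_moment[OF assms(4) this, unfolded dD, folded r_def]
    moreover have "shadow_est M Obs R = (\<lambda>U. \<Sum>b\<in>UNIV. conj_by U R $ b $ b * conj_by U ?Y $ b $ b)"
      unfolding shadow_est_def conj_by_def meas_channel_inv_traceless[OF assms(2)] D_def ..
    ultimately show ?thesis by (simp only:)
  qed
  have "(\<integral>U. (shadow_est M Obs R U)\<^sup>2 \<partial>M) = of_real (D + 1)^2 * W
       / (of_real D * (of_real D + 1) * (of_real D + 2) * (of_real D + 3))"
  proof -
    define k where "k = complex_of_real (D + 1)"
    have tr: "trace (?Y ** ?Y) = k\<^sup>2 * N" "trace (R ** ?Y ** ?Y) = k\<^sup>2 * a" "trace (R ** ?Y) = k * t"
      "trace (R ** R ** ?Y ** ?Y) = k\<^sup>2 * c" "trace (R ** ?Y ** R ** ?Y) = k\<^sup>2 * e"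
      by (simp_all only: scaleR_mult_left scaleR_mult_right trace_scaleR defs k_def power2_eq_square mult.assoc)
    show ?thesis
      unfolding sm tr k_def[symmetric] W_def
      by (rule arg_cong2[where f = "(/)"]) (simp_all add: power2_eq_square algebra_simps)
  qed
  also have "\<dots> = of_real ((D + 1) / (D * (D + 2) * (D + 3))) * W"
  proof -
    have "complex_of_real (D + 1) \<noteq> 0"
      unfolding of_real_eq_0_iff using D by linarith
    then show ?thesis by (simp add: power2_eq_square)
  qed
  finally have s: "(\<integral>U. (shadow_est M Obs R U)\<^sup>2 \<partial>M) = of_real ((D + 1) / (D * (D + 2) * (D + 3))) * W" .
  have ReW: "Re W = ((D + 2) * Re r - 1) * Re N - 4 * Re a + (D + 1) * (D + 4) * (Re t)\<^sup>2
      + 2 * (D + 1) * Re c - 2 * Re e"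
    unfolding W_def by (simp add: im power2_eq_square)
  have Ret: "Re (t\<^sup>2) = (Re t)\<^sup>2" by (simp add: im power2_eq_square)
  define k where "k = D * (D + 2) * (D + 3)"
  have k: "k \<noteq> 0" using D by (simp add: k_def)
  have "Vstar_rho M Obs R = Re (of_real ((D + 1) / k) * W) - (Re t)\<^sup>2"
    unfolding Vstar_rho_def s trace_mul_sym[of Obs R] t_def[symmetric] minus_complex.sel Ret k_def ..
  also have "\<dots> = ((D + 1) * Re W - k * (Re t)\<^sup>2) / k"
    using k by (simp add: diff_divide_distrib)
  \<comment> \<open>The coefficient of \<open>(Re t)^2\<close> is
    \<open>(D + 1)^2 (D + 4) - D (D + 2) (D + 3) = D^2 + 3 D + 4\<close>.\<close>
  also have "(D + 1) * Re W - k * (Re t)\<^sup>2 =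
      (D + 1) * (((D + 2) * Re r - 1) * Re N - 4 * Re a + 2 * (D + 1) * Re c - 2 * Re e)
      + (D\<^sup>2 + 3 * D + 4) * (Re t)\<^sup>2"
    unfolding ReW k_def by (simp add: power2_eq_square algebra_simps)
  finally show ?thesis unfolding defs k_def .
qed

end

section \<open>Bounds over density operators\<close>

lemma norm_cmat_sq: "(norm A)\<^sup>2 = (\<Sum>i\<in>UNIV. \<Sum>j\<in>UNIV. (cmod (A $ i $ j))\<^sup>2)" for A :: "'d::finite cmat"
  by (simp add: norm_vec_def L2_set_def sum_nonneg)

lemma hs_norm_eq_norm: "hs_norm A = norm A"
  by (simp add: hs_norm_def norm_cmat_sq[symmetric])

text \<open>This opens the general Cauchy-Schwarz inequality to traces: the inner product of the
  type is the real Hilbert-Schmidt one.\<close>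

lemma inner_cmat: "inner A B = Re (trace (A ** cadj B))" for A B :: "'d::finite cmat"
  by (simp add: inner_vec_def trace_def matrix_matrix_mult_def cadj_def inner_complex_def)

lemma norm_sq_cmat: "(norm A)\<^sup>2 = Re (trace (A ** cadj A))" for A :: "'d::finite cmat"
  by (simp add: power2_norm_eq_inner inner_cmat)

lemma norm_cadj: "norm (cadj A) = norm A"
proof -
  have "(norm (cadj A))\<^sup>2 = (norm A)\<^sup>2"
    unfolding norm_sq_cmat cadj_cadj by (metis trace_mul_sym)
  then show ?thesis by simp
qed

text \<open>Cauchy-Schwarz for each row of \<open>A\<close> against each column of \<open>B\<close>;
  the double sum of the bounds factors.\<close>

lemma norm_cmat_mult_le: "norm (A ** B) \<le> norm A * norm B" for A B :: "'d::finite cmat"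
proof -
  have "(cmod ((A ** B) $ i $ j))\<^sup>2 \<le> (\<Sum>k\<in>UNIV. (cmod (A $ i $ k))\<^sup>2) * (\<Sum>k\<in>UNIV. (cmod (B $ k $ j))\<^sup>2)" for i j
  proof -
    have "cmod ((A ** B) $ i $ j) \<le> (\<Sum>k\<in>UNIV. cmod (A $ i $ k) * cmod (B $ k $ j))"
      unfolding matrix_matrix_mult_def by (simp flip: norm_mult) (rule norm_sum)
    then have "(cmod ((A ** B) $ i $ j))\<^sup>2 \<le> (\<Sum>k\<in>UNIV. cmod (A $ i $ k) * cmod (B $ k $ j))\<^sup>2"
      by (rule power_mono) simp
    also have "\<dots> \<le> (\<Sum>k\<in>UNIV. (cmod (A $ i $ k))\<^sup>2) * (\<Sum>k\<in>UNIV. (cmod (B $ k $ j))\<^sup>2)"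
      by (rule Cauchy_Schwarz_ineq_sum)
    finally show ?thesis .
  qed
  then have "(norm (A ** B))\<^sup>2 \<le> (\<Sum>i\<in>UNIV. \<Sum>j\<in>UNIV.
      (\<Sum>k\<in>UNIV. (cmod (A $ i $ k))\<^sup>2) * (\<Sum>k\<in>UNIV. (cmod (B $ k $ j))\<^sup>2))"
    unfolding norm_cmat_sq by (intro sum_mono)
  also have "\<dots> = (norm A)\<^sup>2 * (\<Sum>j\<in>UNIV. \<Sum>k\<in>UNIV. (cmod (B $ k $ j))\<^sup>2)"
    unfolding norm_cmat_sq by (simp only: sum_product)
  also have "(\<Sum>j\<in>UNIV. \<Sum>k\<in>UNIV. (cmod (B $ k $ j))\<^sup>2) = (norm B)\<^sup>2"
    unfolding norm_cmat_sq by (rule sum.swap)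
  finally have "(norm (A ** B))\<^sup>2 \<le> (norm A * norm B)\<^sup>2" by (simp add: power_mult_distrib)
  then show ?thesis by (rule power2_le_imp_le) simp
qed

text \<open>Cauchy-Schwarz for \<open>A\<close> and its adjoint, which have the same norm.\<close>

lemma abs_Re_trace_square_le: "\<bar>Re (trace (A ** A))\<bar> \<le> (norm A)\<^sup>2" for A :: "'d::finite cmat"
  using Cauchy_Schwarz_ineq2[of A "cadj A"] by (simp add: inner_cmat norm_cadj power2_eq_square)

section \<open>The positive semidefinite form of a density operator\<close>

definition sform :: "'d::finite cmat \<Rightarrow> complex^'d \<Rightarrow> complex^'d \<Rightarrow> complex" where
  "sform A u v = (\<Sum>i\<in>UNIV. cnj (u $ i) * (A *v v) $ i)"

lemma sform_expand: "sform A u v = (\<Sum>i\<in>UNIV. \<Sum>j\<in>UNIV. cnj (u $ i) * A $ i $ j * v $ j)"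
  by (simp add: sform_def matrix_vector_mult_def sum_distrib_left mult.assoc)

lemma sform_linear:
  "sform A (u + u') v = sform A u v + sform A u' v" "sform A u (v + v') = sform A u v + sform A u v'"
  "sform A (c *s u) v = cnj c * sform A u v" "sform A u (c *s v) = c * sform A u v"
  by (simp_all add: sform_expand sum.distrib sum_distrib_left algebra_simps)

lemma sform_axis: "sform A (axis i 1) v = (A *v v) $ i"
proof -
  have "sform A (axis i 1) v = (\<Sum>k\<in>UNIV. if k = i then (A *v v) $ k else 0)"
    unfolding sform_def by (intro sum.cong refl) (auto simp: axis_def)
  then show ?thesis by simp
qed

lemma mult_axis: "(A *v axis j 1) $ i = (A $ i $ j :: complex)"
proof -
  have "(A *v axis j 1) $ i = (\<Sum>k\<in>UNIV. if k = j then A $ i $ k else 0)"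
    unfolding matrix_vector_mult_def vec_lambda_beta by (intro sum.cong refl) (auto simp: axis_def)
  then show ?thesis by simp
qed

lemma sform_cnj:
  assumes "hermitian_mat A"
  shows "cnj (sform A u v) = sform A v u"
proof -
  have A: "cnj (A $ i $ j) = A $ j $ i" for i j
    using assms by (metis (no_types, lifting) cadj_def hermitian_mat_def vec_lambda_beta)
  have "cnj (sform A u v) = (\<Sum>i\<in>UNIV. \<Sum>j\<in>UNIV. u $ i * A $ j $ i * cnj (v $ j))"
    by (simp add: sform_expand A)
  then show ?thesis
    by (subst (asm) sum.swap) (simp add: sform_expand mult_ac)
qed

lemma density_opD:
  assumes "density_op R"
  shows "hermitian_mat R" "trace R = 1" "Im (sform R v v) = 0" "Re (sform R v v) \<ge> 0"
  using assms by (auto simp: density_op_def sform_def)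

lemma density_Cauchy_Schwarz:
  assumes R: "density_op R"
  shows "(cmod (sform R u v))\<^sup>2 \<le> Re (sform R u u) * Re (sform R v v)"
proof -
  define p q z where "p = Re (sform R u u)" and "q = Re (sform R v v)" and "z = sform R u v"
  have p: "sform R u u = of_real p" and q: "sform R v v = of_real q"
    using density_opD(3)[OF R] by (simp_all add: p_def q_def complex_eq_iff)
  have z': "sform R v u = cnj z"
    using sform_cnj[OF density_opD(1)[OF R], of u v] by (simp add: z_def)
  have q0: "q \<ge> 0" and p0: "p \<ge> 0" using density_opD(4)[OF R] by (simp_all add: p_def q_def)
  have key: "0 \<le> p - 2 * x * (cmod z)\<^sup>2 + x\<^sup>2 * (cmod z)\<^sup>2 * q" for x :: real
  proof -
    \<comment> \<open>The factor \<open>cnj z\<close> aligns the phases, so that both cross terms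
      become the real number \<open>- x |z|^2\<close>.\<close>
    define l where "l = - of_real x * cnj z"
    have "sform R (u + l *s v) (u + l *s v) = of_real p + l * z + cnj l * cnj z + cnj l * l * of_real q"
      by (simp add: sform_linear p q z' z_def[symmetric] algebra_simps)
    also have "\<dots> = of_real p - 2 * of_real x * (z * cnj z) + of_real (x\<^sup>2) * (z * cnj z) * of_real q"
      by (simp add: l_def power2_eq_square algebra_simps)
    also have "\<dots> = of_real (p - 2 * x * (cmod z)\<^sup>2 + x\<^sup>2 * (cmod z)\<^sup>2 * q)"
      unfolding complex_norm_square[symmetric] by simp
    finally have "Re (sform R (u + l *s v) (u + l *s v)) = p - 2 * x * (cmod z)\<^sup>2 + x\<^sup>2 * (cmod z)\<^sup>2 * q"
      by simp
    then show ?thesis using density_opD(4)[OF R, of "u + l *s v"] by simp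
  qed
  have "(cmod z)\<^sup>2 \<le> p * q"
  proof (cases "q = 0")
    case True
    show ?thesis
    proof (cases "z = 0")
      case False
      then have "(cmod z)\<^sup>2 > 0" by simp
      \<comment> \<open>The form may be degenerate. For \<open>q = 0\<close> the bound in
        \<open>key\<close> is affine in \<open>x\<close>, and this \<open>x\<close> would make it
        \<open>-1\<close>.\<close>
      then show ?thesis using key[of "(p + 1) / (2 * (cmod z)\<^sup>2)"] True by simp
    qed (use True in simp)
  next
    case False
    then have "q > 0" using q0 by simp
    then have "(cmod z)\<^sup>2 / q \<le> p" using key[of "1 / q"] by (simp add: power2_eq_square)
    then show ?thesis using \<open>q > 0\<close> by (simp add: pos_divide_le_eq)
  qed
  then show ?thesis by (simp add: p_def q_def z_def)
qed

lemma sum_diagonal_density: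
  assumes "density_op R"
  shows "(\<Sum>i\<in>UNIV. Re (sform R (axis i 1) (axis i 1))) = 1"
  using density_opD(2)[OF assms] by (simp add: sform_axis mult_axis trace_def flip: Re_sum)

text \<open>Positivity bounds \<open>|R_ij|^2\<close> by \<open>R_ii R_jj\<close>, and these bounds
  sum to the square of the trace. Purity is bounded without diagonalizing \<open>R\<close>.\<close>

lemma norm_density_le_1:
  assumes R: "density_op R"
  shows "norm R \<le> 1"
proof -
  let ?s = "\<lambda>i. Re (sform R (axis i 1) (axis i 1))"
  have "(cmod (R $ i $ j))\<^sup>2 \<le> ?s i * ?s j" for i j
    using density_Cauchy_Schwarz[OF R, of "axis i 1" "axis j 1"] by (simp add: sform_axis mult_axis)
  then have "(norm R)\<^sup>2 \<le> (\<Sum>i\<in>UNIV. \<Sum>j\<in>UNIV. ?s i * ?s j)"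
    unfolding norm_cmat_sq by (intro sum_mono)
  also have "\<dots> = 1"
    by (simp only: sum_product[symmetric] sum_diagonal_density[OF R] mult_1_left)
  finally show ?thesis by (simp add: abs_square_le_1)
qed

lemma norm_vec_sq: "(norm v)\<^sup>2 = (\<Sum>i\<in>UNIV. (cmod (v $ i))\<^sup>2)" for v :: "complex^'d"
  by (simp add: norm_vec_def L2_set_def sum_nonneg)

text \<open>Cauchy-Schwarz for the form of \<open>R\<close> between each basis vector and
  \<open>v\<close>, summed with total weight \<open>trace R = 1\<close>. In operator terms
  \<open>R^2\<close> is at most \<open>R\<close>.\<close>

lemma norm_density_apply_le:
  assumes R: "density_op R"
  shows "(norm (R *v v))\<^sup>2 \<le> Re (sform R v v)"
proof -
  have "(cmod ((R *v v) $ i))\<^sup>2 \<le> Re (sform R (axis i 1) (axis i 1)) * Re (sform R v v)" for i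
    using density_Cauchy_Schwarz[OF R, of "axis i 1" v] by (simp add: sform_axis)
  then have "(norm (R *v v))\<^sup>2 \<le> (\<Sum>i\<in>UNIV. Re (sform R (axis i 1) (axis i 1)) * Re (sform R v v))"
    unfolding norm_vec_sq by (intro sum_mono)
  also have "\<dots> = Re (sform R v v)"
    by (simp only: sum_distrib_right[symmetric] sum_diagonal_density[OF R] mult_1_left)
  finally show ?thesis .
qed

section \<open>Rank-one projections\<close>

lemma trace_mult_proj: "trace (A ** proj v) = sform A v v"
  by (simp add: trace_def matrix_matrix_mult_def proj_def sform_expand sum_distrib_left mult_ac)

lemma trace_proj: "trace (proj v) = of_real ((norm v)\<^sup>2)"
  by (simp add: trace_def proj_def norm_vec_sq complex_norm_square del: of_real_power)

lemma cadj_proj: "cadj (proj v) = proj v"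
  by (simp add: cadj_def proj_def vec_eq_iff mult.commute)

text \<open>With \<open>A = R\<close> this converts traces of words in \<open>R\<close> and a
  projection into the norm of \<open>R *v v\<close> and the form of \<open>R\<close>.\<close>

lemma mult_proj_cadj: "A ** proj v ** cadj A = proj (A *v v)"
  by (simp add: vec_eq_iff matrix_matrix_mult_def proj_def cadj_def matrix_vector_mult_def
      sum_distrib_left sum_distrib_right mult_ac)

lemma sform_proj: "sform (proj u) v v = of_real ((cmod (\<Sum>i\<in>UNIV. cnj (v $ i) * u $ i))\<^sup>2)"
proof -
  have "sform (proj u) v v = (\<Sum>i\<in>UNIV. cnj (v $ i) * u $ i) * cnj (\<Sum>i\<in>UNIV. cnj (v $ i) * u $ i)"
    by (simp add: sform_expand proj_def sum_product mult_ac)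
  then show ?thesis by (simp only: complex_norm_square)
qed

lemma density_proj:
  assumes "norm v = 1"
  shows "density_op (proj v)"
  using assms sform_proj[of v, unfolded sform_def]
  by (simp add: density_op_def hermitian_mat_def cadj_proj trace_proj)

text \<open>Cyclically rotated, the trace is the sum of the form of \<open>R\<close> at the columns
  of \<open>Obs\<close>.\<close>

lemma trace_density_obs_nonneg:
  assumes R: "density_op R" and "hermitian_mat Obs"
  shows "Re (trace (R ** Obs ** Obs)) \<ge> 0"
proof -
  have "trace (R ** Obs ** Obs) = trace (Obs ** R ** Obs)"
    by (rule trace_words(3)[symmetric])
  also have "\<dots> = (\<Sum>i\<in>UNIV. sform R (Obs *v axis i 1) (Obs *v axis i 1))"
  proof -
    have O: "cnj (Obs $ i $ j) = Obs $ j $ i" for i j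
      using assms(2) by (metis (no_types, lifting) cadj_def hermitian_mat_def vec_lambda_beta)
    have "(Obs ** R ** Obs) $ i $ i = sform R (Obs *v axis i 1) (Obs *v axis i 1)" for i
      by (simp add: sform_expand mult_axis O matrix_matrix_mult_def sum_distrib_right) (rule sum.swap)
    then show ?thesis by (simp add: trace_def)
  qed
  finally show ?thesis by (simp add: sum_nonneg density_opD(4)[OF R])
qed

lemma proj_idem:
  assumes "norm v = 1"
  shows "proj v ** proj v = proj v"
proof -
  have "(\<Sum>k\<in>UNIV. v $ k * cnj (v $ k)) = 1"
    using trace_proj[of v] assms by (simp add: trace_def proj_def)
  moreover have "(proj v ** proj v) $ i $ j = v $ i * cnj (v $ j) * (\<Sum>k\<in>UNIV. v $ k * cnj (v $ k))" for i j
    by (simp add: matrix_matrix_mult_def proj_def sum_distrib_left mult_ac)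
  ultimately show ?thesis by (simp add: vec_eq_iff proj_def)
qed

section \<open>Upper bounds on the variance\<close>

context design4
begin

text \<open>The traces in the variance formula are estimated one by one: \<open>r \<le> 1\<close>,
  \<open>a \<ge> 0\<close>, \<open>c \<le> N\<close>, \<open>- e \<le> c\<close> and
  \<open>t^2 \<le> N\<close>.\<close>

lemma Vstar_rho_le:
  fixes Obs R :: "'d cmat"
  assumes O: "hermitian_mat Obs" "trace Obs = 0" and R: "density_op R"
  shows "Vstar_rho M Obs R \<le> 4 / real CARD('d) * (hs_norm Obs)\<^sup>2"
proof -
  define D where "D = real CARD('d)"
  have D: "D \<ge> 1" by (simp add: D_def Suc_le_eq)
  have cO: "cadj Obs = Obs" and cR: "cadj R = R"
    using O density_opD(1)[OF R] by (simp_all add: hermitian_mat_def)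
  define N where "N = (norm Obs)\<^sup>2"
  define r a c e t where "r = Re (trace (R ** R))" and "a = Re (trace (R ** Obs ** Obs))"
    and "c = Re (trace (R ** R ** Obs ** Obs))" and "e = Re (trace (R ** Obs ** R ** Obs))"
    and "t = Re (trace (R ** Obs))"
  have N: "Re (trace (Obs ** Obs)) = N" by (simp add: N_def norm_sq_cmat cO)
  have N0: "N \<ge> 0" by (simp add: N_def)
  have R1: "(norm R)\<^sup>2 \<le> 1" using norm_density_le_1[OF R] by (simp add: power_le_one)
  have r: "r \<le> 1" using R1 by (simp add: r_def norm_sq_cmat cR)
  have a: "a \<ge> 0" unfolding a_def by (rule trace_density_obs_nonneg[OF R O(1)])
  have c: "c = (norm (R ** Obs))\<^sup>2"
    unfolding c_def norm_sq_cmat cadj_mult cO cR matrix_mul_assoc trace_words(8)[symmetric] ..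
  have "norm (R ** Obs) \<le> 1 * norm Obs"
    using norm_cmat_mult_le[of R Obs] norm_density_le_1[OF R]
    by (meson mult_right_mono norm_ge_zero order_trans)
  then have cN: "c \<le> N" unfolding c N_def by (intro power_mono) auto
  have e: "- e \<le> c"
    using abs_Re_trace_square_le[of "R ** Obs"] by (simp add: e_def c matrix_mul_assoc)
  have "\<bar>t\<bar> \<le> norm R * norm Obs"
    using Cauchy_Schwarz_ineq2[of R Obs] by (simp add: t_def inner_cmat cO)
  also have "\<dots> \<le> 1 * norm Obs"
    by (intro mult_right_mono norm_density_le_1[OF R]) simp
  finally have t: "t\<^sup>2 \<le> N" unfolding N_def by (simp add: abs_le_square_iff[symmetric])
  have "((D + 2) * r - 1) * N \<le> ((D + 2) * 1 - 1) * N"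
    by (intro mult_right_mono diff_right_mono mult_left_mono r N0) (use D in simp)
  moreover have "2 * (D + 1) * c \<le> 2 * (D + 1) * N"
    by (intro mult_left_mono cN) (use D in simp)
  ultimately have "((D + 2) * r - 1) * N - 4 * a + 2 * (D + 1) * c - 2 * e
      \<le> ((D + 2) * 1 - 1) * N + 2 * (D + 1) * N + 2 * N"
    using a e cN by linarith
  then have 1: "(D + 1) * (((D + 2) * r - 1) * N - 4 * a + 2 * (D + 1) * c - 2 * e)
      \<le> (D + 1) * (((D + 2) * 1 - 1) * N + 2 * (D + 1) * N + 2 * N)"
    by (rule mult_left_mono) (use D in simp)
  have 2: "(D\<^sup>2 + 3 * D + 4) * t\<^sup>2 \<le> (D\<^sup>2 + 3 * D + 4) * N"
    by (intro mult_left_mono t) (use D in simp)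
  \<comment> \<open>This is exactly the slack between the collected estimates and the target
    \<open>4 (D + 2) (D + 3) N\<close>.\<close>
  have "0 \<le> (9 * D + 15) * N" using D N0 by simp
  then have "(D + 1) * (((D + 2) * 1 - 1) * N + 2 * (D + 1) * N + 2 * N) + (D\<^sup>2 + 3 * D + 4) * N
      \<le> 4 * ((D + 2) * (D + 3)) * N"
    by (simp add: power2_eq_square algebra_simps)
  with 1 2 have "(D + 1) * (((D + 2) * r - 1) * N - 4 * a + 2 * (D + 1) * c - 2 * e)
      + (D\<^sup>2 + 3 * D + 4) * t\<^sup>2 \<le> 4 * ((D + 2) * (D + 3)) * N"
    by linarith
  then have "Vstar_rho M Obs R \<le> 4 * ((D + 2) * (D + 3)) * N / (D * (D + 2) * (D + 3))"
    unfolding Vstar_rho_formula[OF O density_opD(1,2)[OF R]] N r_def a_def c_def e_def t_def D_def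
    by (intro divide_right_mono) auto
  also have "\<dots> = 4 / D * N" using D by (simp add: divide_simps)
  finally show ?thesis by (simp add: D_def N_def hs_norm_eq_norm)
qed

text \<open>The numerator is arranged as the maximal value minus four deficits, which all vanish
  when the purity, \<open>(norm (R *v \<phi>))^2\<close> and \<open>f\<close> equal
  \<open>1\<close>, and which are nonnegative for \<open>D \<ge> 2\<close>.\<close>

lemma Vstar_rho_proj:
  fixes \<phi> :: "complex^'d" and R :: "'d cmat"
  assumes \<phi>: "norm \<phi> = 1" and R: "density_op R"
  defines "D \<equiv> real CARD('d)" and "f \<equiv> Re (sform R \<phi> \<phi>)"
  shows "Vstar_rho M (proj \<phi> - (1 / D) *\<^sub>R mat 1) R = (4 * D * (D - 1)
      - ((D + 1) * ((D + 2) * (1 - 1 / D) + 2 / D) * (1 - (norm R)\<^sup>2)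
       + 2 * (D + 1) * (D - 1) * (f - (norm (R *v \<phi>))\<^sup>2)
       + (3 * D + 1) * (D - 2) * (1 - f) + (D\<^sup>2 + D + 2) * (f - f\<^sup>2)))
       / (D * (D + 2) * (D + 3))"
proof -
  let ?P = "proj \<phi>"
  define k where "k = 1 / D"
  define Q where "Q = ?P - k *\<^sub>R mat 1"
  define g r where "g = (norm (R *v \<phi>))\<^sup>2" and "r = (norm R)\<^sup>2"
  have kD: "k * D = 1" by (simp add: k_def D_def)
  have cR: "cadj R = R" using density_opD(1)[OF R] by (simp add: hermitian_mat_def)
  \<comment> \<open>Idempotence in the form that matches words associated to the left.\<close>
  have PP: "A ** ?P ** ?P = A ** ?P" for A
    by (metis matrix_mul_assoc proj_idem[OF \<phi>])
  have dD: "of_nat CARD('d) = complex_of_real D" by (simp add: D_def)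
  have trP: "trace ?P = 1" by (simp add: trace_proj \<phi>)
  have trR: "trace R = 1" by (rule density_opD(2)[OF R])
  have RP: "Re (trace (R ** ?P)) = f" by (simp add: trace_mult_proj f_def)
  have RR: "Re (trace (R ** R)) = r" by (simp add: r_def norm_sq_cmat cR)
  have RRP: "trace (R ** R ** ?P) = of_real g" "trace (R ** ?P ** R) = of_real g"
    using mult_proj_cadj[of R \<phi>] trace_words(5)[of R ?P]
    by (simp_all add: cR trace_proj g_def)
  have RPRP: "Re (trace (R ** ?P ** R ** ?P)) = f\<^sup>2"
  proof -
    have "trace (R ** ?P ** R ** ?P) = of_real ((cmod (sform R \<phi> \<phi>))\<^sup>2)"
      using mult_proj_cadj[of R \<phi>] by (simp only: cR trace_mult_proj sform_proj sform_def[of R])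
    moreover have "sform R \<phi> \<phi> = of_real f"
      using density_opD(3)[OF R] by (simp add: f_def complex_eq_iff)
    ultimately show ?thesis by simp
  qed
  note expand = mult_diff_left mult_diff_right scaleR_mult_left scaleR_mult_right PP proj_idem[OF \<phi>]
    matrix_mul_rid matrix_mul_lid trace_sub trace_scaleR scaleR_diff_right scaleR_scaleR
  have trO: "trace Q = 0"
    using kD by (simp add: Q_def trace_sub trP trace_scaleR trace_I dD flip: of_real_mult)
  have hO: "hermitian_mat Q"
    unfolding hermitian_mat_def Q_def
    by (simp add: cadj_def vec_eq_iff proj_def mat_def mult.commute)
  have OO: "Re (trace (Q ** Q)) = 1 - k"
  proof -
    have "trace (Q ** Q) = 1 - 2 * k + k * (k * D)"
      by (simp only: Q_def expand trP trace_I dD) (simp add: algebra_simps)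
    then show ?thesis by (simp add: kD)
  qed
  have RO: "Re (trace (R ** Q)) = f - k"
    by (simp only: Q_def expand) (simp add: RP trR)
  have ROO: "Re (trace (R ** Q ** Q)) = (1 - 2 * k) * f + k\<^sup>2"
    by (simp only: Q_def expand) (simp add: RP trR power2_eq_square algebra_simps)
  have RROO: "Re (trace (R ** R ** Q ** Q)) = (1 - 2 * k) * g + k\<^sup>2 * r"
    by (simp only: Q_def expand) (simp add: RR RRP power2_eq_square algebra_simps)
  have RORO: "Re (trace (R ** Q ** R ** Q)) = f\<^sup>2 - 2 * k * g + k\<^sup>2 * r"
    by (simp only: Q_def expand) (simp add: RR RRP RPRP power2_eq_square algebra_simps)
  \<comment> \<open>With \<open>k\<close> for \<open>1 / D\<close> this is a polynomial identity
    modulo \<open>k * D = 1\<close>.\<close>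
  have "(D + 1) * (((D + 2) * r - 1) * (1 - k) - 4 * ((1 - 2 * k) * f + k\<^sup>2)
      + 2 * (D + 1) * ((1 - 2 * k) * g + k\<^sup>2 * r) - 2 * (f\<^sup>2 - 2 * k * g + k\<^sup>2 * r))
      + (D\<^sup>2 + 3 * D + 4) * (f - k)\<^sup>2
    = 4 * D * (D - 1) - ((D + 1) * ((D + 2) * (1 - k) + 2 * k) * (1 - r)
       + 2 * (D + 1) * (D - 1) * (f - g)
       + (3 * D + 1) * (D - 2) * (1 - f) + (D\<^sup>2 + D + 2) * (f - f\<^sup>2))"
    using kD by algebra
  then show ?thesis
    using Vstar_rho_formula[OF hO trO density_opD(1)[OF R] trR]
    unfolding RR OO ROO RROO RORO RO D_def[symmetric]
    by (simp add: Q_def k_def g_def r_def)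
qed

lemma Vstar_rho_proj_self:
  fixes \<phi> :: "complex^'d"
  assumes \<phi>: "norm \<phi> = 1"
  defines "D \<equiv> real CARD('d)"
  shows "Vstar_rho M (proj \<phi> - (1 / D) *\<^sub>R mat 1) (proj \<phi>) = 4 * (D - 1) / ((D + 2) * (D + 3))"
proof -
  have "norm (proj \<phi>) = 1"
    using norm_sq_cmat[of "proj \<phi>"] by (simp add: cadj_proj proj_idem trace_proj \<phi> abs_square_eq_1)
  moreover have f: "sform (proj \<phi>) \<phi> \<phi> = 1"
    using trace_mult_proj[of "proj \<phi>" \<phi>] by (simp add: proj_idem trace_proj \<phi>)
  moreover have "(norm (proj \<phi> *v \<phi>))\<^sup>2 = 1"
  proof -
    have "complex_of_real ((norm (proj \<phi> *v \<phi>))\<^sup>2) = trace (proj \<phi> ** proj \<phi> ** cadj (proj \<phi>))"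
      by (simp only: mult_proj_cadj trace_proj)
    also have "\<dots> = 1" by (simp add: cadj_proj proj_idem trace_proj \<phi>)
    finally show ?thesis using of_real_eq_1_iff by blast
  qed
  moreover have "D > 0" by (simp add: D_def)
  ultimately show ?thesis
    using Vstar_rho_proj[OF \<phi> density_proj[OF \<phi>]] by (simp flip: D_def)
qed

text \<open>Every deficit in \<open>Vstar_rho_proj\<close> is nonnegative; the assumption on the
  dimension gives the sign of the factor \<open>D - 2\<close>.\<close>

lemma Vstar_rho_proj_le:
  fixes \<phi> :: "complex^'d" and R :: "'d cmat"
  assumes \<phi>: "norm \<phi> = 1" and R: "density_op R" and dim: "CARD('d) \<ge> 2"
  shows "Vstar_rho M (proj \<phi> - (1 / real CARD('d)) *\<^sub>R mat 1) R
    \<le> Vstar_rho M (proj \<phi> - (1 / real CARD('d)) *\<^sub>R mat 1) (proj \<phi>)"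
proof -
  define D where "D = real CARD('d)"
  define f where "f = Re (sform R \<phi> \<phi>)"
  have D: "D \<ge> 2" using dim by (simp add: D_def)
  have R1: "(norm R)\<^sup>2 \<le> 1" using norm_density_le_1[OF R] by (simp add: power_le_one)
  have g: "(norm (R *v \<phi>))\<^sup>2 \<le> f" unfolding f_def by (rule norm_density_apply_le[OF R])
  have f0: "f \<ge> 0" unfolding f_def by (rule density_opD(4)[OF R])
  \<comment> \<open>The fidelity is the inner product of two density operators, each of norm at most
    \<open>1\<close>.\<close>
  have "f = inner R (proj \<phi>)" by (simp add: f_def inner_cmat cadj_proj trace_mult_proj)
  also have "\<dots> \<le> norm R * norm (proj \<phi>)" by (rule norm_cauchy_schwarz)
  also have "\<dots> \<le> 1 * 1"
    by (intro mult_mono norm_density_le_1 R density_proj \<phi>) auto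
  finally have f1: "f \<le> 1" by simp
  have ff: "f\<^sup>2 \<le> f" using f0 f1 by (simp add: power2_eq_square mult_left_le)
  have "0 \<le> (D + 1) * ((D + 2) * (1 - 1 / D) + 2 / D) * (1 - (norm R)\<^sup>2)"
    "0 \<le> 2 * (D + 1) * (D - 1) * (f - (norm (R *v \<phi>))\<^sup>2)"
    "0 \<le> (3 * D + 1) * (D - 2) * (1 - f)" "0 \<le> (D\<^sup>2 + D + 2) * (f - f\<^sup>2)"
    using D R1 g f1 ff by simp_all
  then have "Vstar_rho M (proj \<phi> - (1 / D) *\<^sub>R mat 1) R \<le> 4 * D * (D - 1) / (D * (D + 2) * (D + 3))"
    unfolding Vstar_rho_proj[OF \<phi> R, folded D_def f_def]
    by (intro divide_right_mono) (use D in auto)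
  also have "\<dots> = 4 * (D - 1) / ((D + 2) * (D + 3))" using D by simp
  finally show ?thesis
    unfolding Vstar_rho_proj_self[OF \<phi>] by (simp add: D_def)
qed

end

theorem theorem2:
  fixes M :: "('d::finite) cmat measure" and n :: nat
  assumes "n \<ge> 1" and "CARD('d) = 2 ^ n"
    and "unitary_design 4 M"
  shows "(\<forall>Obs :: 'd cmat. hermitian_mat Obs \<and> trace Obs = 0 \<longrightarrow>
           Vstar M Obs \<le> 4 / real CARD('d) * (hs_norm Obs)\<^sup>2) \<and>
         (\<forall>\<phi> :: complex^'d. norm \<phi> = 1 \<longrightarrow>
           (let Obs = proj \<phi> - (1 / real CARD('d)) *\<^sub>R mat 1 in
              Vstar M Obs = Vstar_rho M Obs (proj \<phi>) \<and>
              Vstar_rho M Obs (proj \<phi>) =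
                4 * (real CARD('d) - 1) / ((real CARD('d) + 2) * (real CARD('d) + 3)) \<and>
              4 * (real CARD('d) - 1) / ((real CARD('d) + 2) * (real CARD('d) + 3))
                < 4 / real CARD('d)))"
proof -
  interpret design4 M by (unfold_locales) (rule assms(3))
  have dim: "CARD('d) \<ge> 2"
    unfolding assms(2) using power_increasing[of 1 n "2::nat"] assms(1) by simp
  have "Vstar M Obs \<le> 4 / real CARD('d) * (hs_norm Obs)\<^sup>2"
    if "hermitian_mat Obs" "trace Obs = 0" for Obs
    unfolding Vstar_def
  proof (rule cSUP_least)
    \<comment> \<open>A bound on a supremum of reals requires a nonempty set; any basis state is a
      witness.\<close>
    have "density_op (proj (axis undefined 1 :: complex^'d))"
      by (rule density_proj) (simp add: norm_axis_1)
    then show "{R :: 'd cmat. density_op R} \<noteq> {}" by blast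
  qed (use Vstar_rho_le that in blast)
  \<comment> \<open>The supremum is a maximum: \<open>proj \<phi>\<close> is itself a density
    operator and dominates all others.\<close>
  moreover have "Vstar M (proj \<phi> - (1 / real CARD('d)) *\<^sub>R mat 1) =
      Vstar_rho M (proj \<phi> - (1 / real CARD('d)) *\<^sub>R mat 1) (proj \<phi>)"
    if "norm \<phi> = 1" for \<phi> :: "complex^'d"
    unfolding Vstar_def
    by (rule cSup_eq_maximum) (use density_proj Vstar_rho_proj_le that dim in auto)
  moreover have "4 * (real CARD('d) - 1) / ((real CARD('d) + 2) * (real CARD('d) + 3)) < 4 / real CARD('d)"
  proof -
    define D where "D = real CARD('d)"
    have "D \<ge> 2" using dim by (simp add: D_def)
    then have "4 * (D - 1) * D < 4 * ((D + 2) * (D + 3))" by (simp add: algebra_simps)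
    moreover have "(D + 2) * (D + 3) > 0" using \<open>D \<ge> 2\<close> by simp
    ultimately have "4 * (D - 1) / ((D + 2) * (D + 3)) < 4 / D"
      using \<open>D \<ge> 2\<close> by (simp only: pos_divide_less_eq times_divide_eq_left) (simp add: pos_less_divide_eq)
    then show ?thesis by (simp add: D_def)
  qed
  ultimately show ?thesis
    unfolding Let_def using Vstar_rho_proj_self by blast
qed

end
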